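(* Let $b\ge0$, $\omega>0$ and $-2\sqrt{\omega}<c<2\sqrt{\omega}$ be fixed, and set $a=\omega-\frac{c^2}{4}$, $\gamma=1+\frac{16b}{3}$. Assume that $$k_0=\frac1\gamma\left(2c+2\sqrt{c^2+4a\gamma}\right)>e^{\frac13}.$$ For $p\geq 4$ let $\varphi=\varphi_{\omega,c}$ be the positive, even $H^1(\mathbb{R})$ solution of $$-\varphi_{xx}+\left(\omega-\tfrac{c^2}{4}\right)\varphi+\tfrac{c}{2}|\varphi|^2\varphi-\tfrac{3}{16}|\varphi|^4\varphi-b|\varphi|^p\varphi=0,$$ and let $\varphi_0$ be the corresponding solution for $p=4$ (same $b$). Then, for $p$ sufficiently close to $4$, $$\|\varphi-\varphi_0\|_{L^\infty}=O(\sqrt[4]{p-4}),\qquad \|\varphi-\varphi_0\|_{L^2}=O(\sqrt[4]{p-4}).$$ Moreover, $$\|\partial_\omega\varphi-\partial_\omega\varphi_0\|_{L^2}=O(\sqrt[4]{p-4})\qquad\text{and}\qquad\|\partial_c\varphi-\partial_c\varphi_0\|_{L^2}=O(\sqrt[4]{p-4}).$$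
   Context: $O(\sqrt[4]{p-4})$ denotes a quantity bounded by $C\sqrt[4]{p-4}$ with $C>0$ independent of $p$ (as $p\downarrow4$, with $\omega,c,b$ fixed). $\partial_\omega\varphi$ and $\partial_c\varphi$ are the derivatives of the profile with respect to the parameters $\omega$ and $c$ (with $b,p$ fixed). Explicitly, $\varphi_0>0$ and $$\varphi_0^2(x)=\frac{8a}{\sqrt{c^2+4\gamma a}\cosh(2\sqrt{a}\,x)-c}.$$ *)

theory Defs
  imports "HOL-Probability.Essential_Supremum"
begin

definition L2 :: "(real \<Rightarrow> real) \<Rightarrow> bool" where
  "L2 f \<longleftrightarrow> f \<in> borel_measurable lborel \<and> integrable lborel (\<lambda>x. (f x)\<^sup>2)"

text \<open>The norms take values in the extended reals. A function outside $L^2$ has infinite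
  norm, so a finite bound on the norm contains membership in the space; likewise
  \<^const>\<open>esssup\<close> is infinite on non-measurable functions.\<close>

definition L2_norm :: "(real \<Rightarrow> real) \<Rightarrow> ereal" where
  "L2_norm f = (if L2 f then ereal (sqrt (\<integral>x. (f x)\<^sup>2 \<partial>lborel)) else \<infinity>)"

definition Linf_norm :: "(real \<Rightarrow> real) \<Rightarrow> ereal" where
  "Linf_norm f = esssup lborel (\<lambda>x. ereal \<bar>f x\<bar>)"

definition test_function :: "(real \<Rightarrow> real) \<Rightarrow> bool" where
  "test_function \<psi> \<longleftrightarrow>
     (\<forall>n x. (deriv ^^ n) \<psi> differentiable (at x)) \<and> compact (closure {x. \<psi> x \<noteq> 0})"

definition weak_deriv :: "(real \<Rightarrow> real) \<Rightarrow> (real \<Rightarrow> real) \<Rightarrow> bool" where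
  "weak_deriv f g \<longleftrightarrow>
     (\<forall>\<psi>. test_function \<psi> \<longrightarrow>
        (\<integral>x. f x * deriv \<psi> x \<partial>lborel) = - (\<integral>x. g x * \<psi> x \<partial>lborel))"

definition H1 :: "(real \<Rightarrow> real) \<Rightarrow> bool" where
  "H1 f \<longleftrightarrow> L2 f \<and> (\<exists>g. L2 g \<and> weak_deriv f g)"

text \<open>Positive, even $H^1$ solutions of the profile equation. The equation is read in the
  classical sense. This loses nothing: every $H^1$ weak solution has a $C^2$ representative, and
  choosing it makes the pointwise values, and their derivatives in the parameters, well defined.\<close>

definition is_profile ::
    "real \<Rightarrow> real \<Rightarrow> real \<Rightarrow> real \<Rightarrow> (real \<Rightarrow> real) \<Rightarrow> bool" where
  "is_profile b p \<omega> c \<phi> \<longleftrightarrow>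
     H1 \<phi> \<and> (\<forall>x. \<phi> x > 0) \<and> (\<forall>x. \<phi> (- x) = \<phi> x) \<and>
     (\<forall>x. \<phi> differentiable (at x)) \<and> (\<forall>x. deriv \<phi> differentiable (at x)) \<and>
     (\<forall>x. - deriv (deriv \<phi>) x + (\<omega> - c\<^sup>2 / 4) * \<phi> x + c / 2 * \<bar>\<phi> x\<bar> ^ 2 * \<phi> x
            - 3 / 16 * \<bar>\<phi> x\<bar> ^ 4 * \<phi> x - b * \<bar>\<phi> x\<bar> powr p * \<phi> x = 0)"

text \<open>A family of profiles is written \<open>\<phi> p \<omega> c x\<close>, with \<open>b\<close> fixed; the next two operators are
  its pointwise partial derivatives in the parameters.\<close>

definition d_omega ::
    "(real \<Rightarrow> real \<Rightarrow> real \<Rightarrow> real \<Rightarrow> real) \<Rightarrow> real \<Rightarrow> real \<Rightarrow> real \<Rightarrow> real \<Rightarrow> real" where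
  "d_omega \<phi> p \<omega> c x = deriv (\<lambda>w. \<phi> p w c x) \<omega>"

definition d_c ::
    "(real \<Rightarrow> real \<Rightarrow> real \<Rightarrow> real \<Rightarrow> real) \<Rightarrow> real \<Rightarrow> real \<Rightarrow> real \<Rightarrow> real \<Rightarrow> real" where
  "d_c \<phi> p \<omega> c x = deriv (\<lambda>d. \<phi> p \<omega> d x) c"

end

theory Submission
  imports Defs "HOL-Probability.Sinc_Integral"
begin

text \<open>
  The idea is to replace a profile \<open>\<phi>\<close> by \<open>u = 1 / \<phi>\<^sup>2\<close>.  Write \<open>A = \<omega> - c\<^sup>2 / 4\<close>.  The profile
  equation has a first integral, which vanishes because \<open>\<phi>\<close> is positive and square integrable
  (\<open>profile_first_integral\<close>).  Combining it with the equation gives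
  \<open>u'' = 4 A u + c / 2 + \<epsilon> u powr (1 - p / 2)\<close> with \<open>\<epsilon> = 2 b (p - 4) / (p + 2)\<close>, together with
  \<open>u' 0 = 0\<close> and an algebraic equation for \<open>u 0\<close> (\<open>inv_square_profile\<close>).  At \<open>p = 4\<close> the equation
  is linear and \<open>u\<close> is a constant plus a multiple of a hyperbolic cosine.  For \<open>p\<close> near \<open>4\<close> the nonlinear
  term has a coefficient of size \<open>p - 4\<close> and is bounded, because \<open>u\<close> stays above a positive
  constant.

  Every comparison of two such functions is then a statement about a linear equation
  \<open>z'' = Q z + r\<close> with \<open>Q \<ge> 0\<close>: a supersolution \<open>K exp (\<mu> x)\<close> dominates \<open>z\<close>
  (\<open>growth_bound\<close>), so exponential bounds on the right-hand side \<open>r\<close> pass to the solution.  Applied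
  to \<open>u\<^sub>p - u\<^sub>4\<close> this gives a difference of size \<open>(p - 4) exp (\<mu> \<bar>x\<bar>)\<close>; the initial values
  differ by \<open>O(p - 4)\<close> since the algebraic equation for them is uniformly nondegenerate.

  For the derivatives in the parameters, let \<open>(\<omega>, c)\<close> run along a line with parameter \<open>h\<close>.  The
  difference quotients in \<open>h\<close> solve linear equations as well.  They are Cauchy as \<open>h\<close> tends to \<open>0\<close>
  (\<open>U_second_order\<close>), which proves differentiability directly, and the quotients for \<open>p\<close> and for \<open>4\<close> differ by \<open>O(p - 4)\<close> uniformly in \<open>h\<close>
  (\<open>U_mixed_diff\<close>), a bound which survives the limit.

  The growth exponent is \<open>\<mu> = 9/4 \<surd>A\<close>, slightly above the true rate \<open>2 \<surd>A\<close> of \<open>u\<close>.  Since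
  \<open>\<phi> = u powr (-1/2)\<close> and \<open>u \<ge> k exp (2 \<surd>A \<bar>x\<bar>)\<close>, differences of profiles and of their
  derivatives carry enough negative powers of \<open>u\<close> to decay like \<open>exp (- \<surd>A \<bar>x\<bar> / 2)\<close>
  (\<open>\<Phi>_decay\<close>).  This bounds all the norms by a multiple of \<open>p - 4\<close>, which is at most the fourth
  root of \<open>p - 4\<close> when \<open>p \<le> 5\<close>.
\<close>


section \<open>Comparison for second-order linear equations\<close>

text \<open>Until \<open>D\<close> first vanishes, \<open>D''\<close> is nonnegative, so \<open>D'\<close> is nonnegative and \<open>D\<close> is at least
  \<open>D 0\<close>; hence it cannot vanish.  Since only the sign of \<open>Q\<close>
  matters, \<open>Q\<close> may be a potential that the mean value theorem provides point by point.\<close>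

lemma comparison_pos:
  fixes D D' D'' Q :: "real \<Rightarrow> real"
  assumes D: "\<And>x. (D has_real_derivative D' x) (at x)"
    and D': "\<And>x. (D' has_real_derivative D'' x) (at x)"
    and ge: "\<And>x. 0 \<le> x \<Longrightarrow> Q x * D x \<le> D'' x"
    and Q: "\<And>x. 0 \<le> x \<Longrightarrow> 0 \<le> Q x"
    and "0 < D 0" "0 \<le> D' 0" and x: "0 \<le> x"
  shows "0 < D x"
proof (rule ccontr)
  assume neg: "\<not> 0 < D x"
  define S where "S = {0..x} \<inter> {y. D y \<le> 0}"
  have cont: "continuous_on UNIV D"
    using D by (meson DERIV_isCont continuous_at_imp_continuous_on)
  have "closed S" unfolding S_def
    by (intro closed_Int closed_Collect_le cont continuous_intros)
  moreover have "S \<noteq> {}" "bdd_below S" using neg x by (auto simp: S_def)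
  ultimately have inS: "Inf S \<in> S" and low: "\<And>y. y \<in> S \<Longrightarrow> Inf S \<le> y"
    by (auto intro: closed_contains_Inf cInf_lower)
  define x0 where "x0 = Inf S"
  have x0: "0 \<le> x0" "x0 \<le> x" "D x0 \<le> 0" using inS by (auto simp: S_def x0_def)
  have "0 < x0" using x0 \<open>0 < D 0\<close> by (cases "x0 = 0") auto
  have pos: "0 < D y" if "0 \<le> y" "y < x0" for y
    using low[of y] that x0 unfolding S_def x0_def by force
  obtain y where y: "0 < y" "y < x0" "D x0 - D 0 = (x0 - 0) * D' y"
    using MVT2[OF \<open>0 < x0\<close>, of D D'] D by auto
  obtain w where w: "0 < w" "w < y" "D' y - D' 0 = (y - 0) * D'' w"
    using MVT2[OF \<open>0 < y\<close>, of D' D''] D' by auto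
  have "0 \<le> D'' w" using ge[of w] Q[of w] pos[of w] w y
    by (smt (verit) mult_nonneg_nonneg)
  then have "0 \<le> D' y" using w \<open>0 \<le> D' 0\<close> by (smt (verit) mult_nonneg_nonneg)
  then have "0 \<le> D x0 - D 0" using y x0 by simp
  with x0 \<open>0 < D 0\<close> show False by simp
qed

text \<open>For a constant potential the weak inequalities at \<open>0\<close> suffice: add a small multiple of the
  exact solution \<open>exp (l x)\<close> and let the multiple tend to \<open>0\<close>.\<close>

lemma comparison_nonneg:
  fixes D D' D'' :: "real \<Rightarrow> real"
  assumes D: "\<And>x. (D has_real_derivative D' x) (at x)"
    and D': "\<And>x. (D' has_real_derivative D'' x) (at x)"
    and ge: "\<And>x. 0 \<le> x \<Longrightarrow> l\<^sup>2 * D x \<le> D'' x"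
    and l: "0 \<le> l" and "0 \<le> D 0" "0 \<le> D' 0" and x: "0 \<le> x"
  shows "0 \<le> D x"
proof -
  have "0 < D x + e * exp (l * x)" if "0 < e" for e
  proof (rule comparison_pos[where D = "\<lambda>x. D x + e * exp (l * x)" and Q = "\<lambda>_. l\<^sup>2"
        and D' = "\<lambda>x. D' x + e * l * exp (l * x)"
        and D'' = "\<lambda>x. D'' x + e * l * l * exp (l * x)"])
    show "l\<^sup>2 * (D x + e * exp (l * x)) \<le> D'' x + e * l * l * exp (l * x)" if "0 \<le> x" for x
      using ge[OF that] by (simp add: algebra_simps power2_eq_square)
  qed (use assms \<open>0 < e\<close> in \<open>auto intro!: derivative_eq_intros D D' simp: add_nonneg_pos\<close>)
  from this[of "e / exp (l * x)" for e] have "0 < D x + e" if "0 < e" for e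
    using that by simp
  then have "0 \<le> D x + e" if "0 < e" for e using that less_imp_le by blast
  then show ?thesis by (rule field_le_epsilon)
qed

text \<open>The function \<open>K exp (\<mu> x)\<close> with \<open>K = Z + R / d\<close> is a supersolution: the gap \<open>d\<close> between \<open>Q\<close> and
  \<open>\<mu>\<^sup>2\<close> absorbs the right-hand side \<open>r\<close>.  Every
  exponential upper bound below is an instance of this estimate.\<close>

lemma growth_bound:
  fixes z z' Q r :: "real \<Rightarrow> real"
  assumes z: "\<And>x. (z has_real_derivative z' x) (at x)"
    and z': "\<And>x. (z' has_real_derivative Q x * z x + r x) (at x)"
    and z'0: "z' 0 = 0"
    and Q: "\<And>x. 0 \<le> x \<Longrightarrow> 0 \<le> Q x" "\<And>x. 0 \<le> x \<Longrightarrow> Q x + d \<le> \<mu>\<^sup>2"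
    and d: "0 < d" and mu: "0 < \<mu>"
    and r: "\<And>x. 0 \<le> x \<Longrightarrow> \<bar>r x\<bar> \<le> R * exp (\<mu> * x)"
    and Z: "\<bar>z 0\<bar> \<le> Z" and x: "0 \<le> x"
  shows "\<bar>z x\<bar> \<le> (Z + R / d) * exp (\<mu> * x)"
proof -
  have R: "0 \<le> R" using r[of 0] by simp
  have main: "0 < (Z + R / d + e) * exp (\<mu> * x) + s * z x" if e: "0 < e" and s: "\<bar>s\<bar> = 1" for e s
  proof (rule comparison_pos[where D = "\<lambda>x. (Z + R / d + e) * exp (\<mu> * x) + s * z x" and Q = Q
        and D' = "\<lambda>x. (Z + R / d + e) * \<mu> * exp (\<mu> * x) + s * z' x"
        and D'' = "\<lambda>x. (Z + R / d + e) * \<mu> * \<mu> * exp (\<mu> * x) + s * (Q x * z x + r x)"])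
    fix x :: real assume x: "0 \<le> x"
    have K: "R \<le> d * (Z + R / d + e)" "0 \<le> Z + R / d + e"
      using d Z e R by (auto simp: algebra_simps intro: add_nonneg_nonneg)
    have "Q x * ((Z + R / d + e) * exp (\<mu> * x)) + R * exp (\<mu> * x)
        \<le> Q x * ((Z + R / d + e) * exp (\<mu> * x)) + d * (Z + R / d + e) * exp (\<mu> * x)"
      by (intro add_left_mono mult_right_mono K) auto
    also have "\<dots> = (Q x + d) * ((Z + R / d + e) * exp (\<mu> * x))"
      by (simp only: distrib_right mult.assoc)
    also have "\<dots> \<le> \<mu>\<^sup>2 * ((Z + R / d + e) * exp (\<mu> * x))"
      by (intro mult_right_mono Q x mult_nonneg_nonneg K) auto
    finally have "Q x * ((Z + R / d + e) * exp (\<mu> * x)) + R * exp (\<mu> * x)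
        \<le> (Z + R / d + e) * \<mu> * \<mu> * exp (\<mu> * x)"
      by (simp add: power2_eq_square mult_ac)
    moreover have "\<bar>s * r x\<bar> \<le> R * exp (\<mu> * x)" using r[OF x] s by (simp add: abs_mult)
    ultimately show "Q x * ((Z + R / d + e) * exp (\<mu> * x) + s * z x)
        \<le> (Z + R / d + e) * \<mu> * \<mu> * exp (\<mu> * x) + s * (Q x * z x + r x)"
      by (simp add: algebra_simps abs_le_iff)
  next
    have "\<bar>s * z 0\<bar> \<le> Z" using Z s by (simp add: abs_mult)
    moreover have "0 \<le> R / d" using R d by simp
    ultimately show "0 < (Z + R / d + e) * exp (\<mu> * 0) + s * z 0" using e by simp
    show "0 \<le> (Z + R / d + e) * \<mu> * exp (\<mu> * 0) + s * z' 0"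
      using z'0 mu Z e R d by simp
  qed (use Q x in \<open>auto intro!: derivative_eq_intros z z'\<close>)
  have "\<bar>z x\<bar> \<le> (Z + R / d) * exp (\<mu> * x) + e" if "0 < e" for e
    using main[of "e / exp (\<mu> * x)" 1] main[of "e / exp (\<mu> * x)" "-1"] that
    by (simp add: algebra_simps abs_le_iff)
  then show ?thesis by (rule field_le_epsilon)
qed

section \<open>Negative powers away from zero\<close>

lemma powr_neg_mvt:
  fixes x y lo q :: real
  assumes "0 < lo" "lo \<le> x" "lo \<le> y"
  shows "\<exists>z\<ge>lo. \<bar>z - y\<bar> \<le> \<bar>x - y\<bar> \<and>
           x powr (-q) - y powr (-q) = - (q * z powr (-q - 1)) * (x - y)"
proof -
  have der: "((\<lambda>x. x powr (-q)) has_real_derivative - (q * z powr (-q - 1))) (at z)"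
    if "lo \<le> z" for z
    using that assms(1) by (auto intro!: derivative_eq_intros)
  consider "x = y" | "x < y" | "y < x" by linarith
  then show ?thesis
  proof cases
    case 1 then show ?thesis using assms by (intro exI[of _ x]) auto
  next
    case 2
    have "\<exists>z>x. z < y \<and> y powr (-q) - x powr (-q) = (y - x) * - (q * z powr (-q - 1))"
      by (rule MVT2[OF 2]) (use der assms in auto)
    then obtain z where "x < z" "z < y"
      "y powr (-q) - x powr (-q) = (y - x) * - (q * z powr (-q - 1))" by blast
    then show ?thesis using assms by (intro exI[of _ z]) (auto simp: algebra_simps)
  next
    case 3
    have "\<exists>z>y. z < x \<and> x powr (-q) - y powr (-q) = (x - y) * - (q * z powr (-q - 1))"
      by (rule MVT2[OF 3]) (use der assms in auto)
    then obtain z where "y < z" "z < x"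
      "x powr (-q) - y powr (-q) = (x - y) * - (q * z powr (-q - 1))" by blast
    then show ?thesis using assms by (intro exI[of _ z]) (auto simp: algebra_simps)
  qed
qed

text \<open>The secant slope \<open>V\<close> moves the nonlinear term of a difference equation into the potential.
  Its sign makes the potential smaller, and its upper bound keeps the potential nonnegative.\<close>

lemma powr_neg_slope:
  fixes x y lo q :: real
  assumes "0 < lo" "lo \<le> x" "lo \<le> y" "0 \<le> q"
  shows "\<exists>V. 0 \<le> V \<and> V \<le> q * lo powr (-q - 1) \<and> x powr (-q) - y powr (-q) = - V * (x - y)"
proof -
  obtain z where z: "lo \<le> z" "x powr (-q) - y powr (-q) = - (q * z powr (-q - 1)) * (x - y)"
    using powr_neg_mvt[OF assms(1-3)] by blast
  have "z powr (-q - 1) \<le> lo powr (-q - 1)"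
    using powr_mono2'[of "-q - 1" lo z] assms z by auto
  then show ?thesis using z assms by (intro exI[of _ "q * z powr (-q - 1)"]) (auto intro: mult_left_mono)
qed

lemma powr_neg_taylor:
  fixes x y lo q :: real
  assumes "0 < lo" "lo \<le> x" "lo \<le> y" "0 \<le> q"
  shows "\<bar>x powr (-q) - y powr (-q) + q * y powr (-q - 1) * (x - y)\<bar>
           \<le> q * (q + 1) * lo powr (-q - 2) * (x - y)\<^sup>2"
proof -
  obtain z where z: "lo \<le> z" "\<bar>z - y\<bar> \<le> \<bar>x - y\<bar>"
    "x powr (-q) - y powr (-q) = - (q * z powr (-q - 1)) * (x - y)"
    using powr_neg_mvt[OF assms(1-3)] by blast
  have e: "- (q + 1) = -q - 1" "- (q + 1) - 1 = -q - 2" "-q - 1 - 1 = -q - 2" by simp_all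
  obtain V where V: "0 \<le> V" "V \<le> (q + 1) * lo powr (-q - 2)"
    "z powr (-q - 1) - y powr (-q - 1) = - V * (z - y)"
    using powr_neg_slope[OF assms(1) z(1) assms(3), of "q + 1", unfolded e] assms(4) by auto
  have "x powr (-q) - y powr (-q) + q * y powr (-q - 1) * (x - y)
      = - q * (z powr (-q - 1) - y powr (-q - 1)) * (x - y)"
    using z(3) by (simp add: algebra_simps)
  also have "\<dots> = q * V * (z - y) * (x - y)" using V(3) by simp
  finally have "\<bar>x powr (-q) - y powr (-q) + q * y powr (-q - 1) * (x - y)\<bar>
      = q * V * (\<bar>z - y\<bar> * \<bar>x - y\<bar>)" using assms V by (simp add: abs_mult)
  also have "\<dots> \<le> q * ((q + 1) * lo powr (-q - 2)) * (\<bar>x - y\<bar> * \<bar>x - y\<bar>)"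
    using assms V z by (intro mult_mono mult_nonneg_nonneg) auto
  finally show ?thesis by (simp add: power2_eq_square mult.assoc)
qed

text \<open>This controls how fast the power tends to \<open>1\<close> as the exponent tends to \<open>0\<close>, which is what
  happens to the power in the equation for the value at the origin when \<open>p\<close> tends to \<open>4\<close>.\<close>

lemma powr_neg_minus_one_bound:
  fixes x r :: real
  assumes x: "0 < x" and r: "0 \<le> r"
  shows "\<bar>x powr (-r) - 1\<bar> \<le> r * (x + 1 / x) * (1 + x powr (-r))"
proof -
  have ln: "\<bar>ln x\<bar> \<le> x + 1 / x"
  proof -
    have "ln x \<le> x" "ln (1 / x) \<le> 1 / x" using ln_bound[of x] ln_bound[of "1 / x"] x by auto
    moreover have "ln (1 / x) = - ln x" using x by (simp add: ln_div)
    moreover have "0 < 1 / x" using x by simp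
    ultimately show ?thesis using x unfolding abs_le_iff by linarith
  qed
  have conv: "\<bar>exp y - 1\<bar> \<le> \<bar>y\<bar> * (1 + exp y)" for y :: real
  proof -
    have lower: "1 + y \<le> exp y" by (rule exp_ge_add_one_self)
    have "exp y * (1 - y) \<le> exp y * exp (- y)"
      using exp_ge_add_one_self[of "- y"] by (intro mult_left_mono) auto
    then have upper: "exp y - 1 \<le> y * exp y" by (simp add: exp_minus algebra_simps)
    show ?thesis
    proof (cases "0 \<le> y")
      case True
      moreover have "1 \<le> exp y" using True by simp
      ultimately have "\<bar>exp y - 1\<bar> = exp y - 1" "\<bar>y\<bar> = y" by simp_all
      then show ?thesis using upper True unfolding distrib_left by linarith
    next
      case False
      moreover have "exp y < 1" using False by simp
      ultimately have "\<bar>exp y - 1\<bar> = 1 - exp y" "\<bar>y\<bar> = - y" by simp_all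
      moreover have "\<bar>y\<bar> * exp y = - (y * exp y)" "y * exp y \<le> 0"
        using False by (simp_all add: mult_nonpos_nonneg)
      ultimately show ?thesis using lower unfolding distrib_left by linarith
    qed
  qed
  have pw: "x powr (-r) = exp (- r * ln x)" using x by (simp add: powr_def)
  have "\<bar>x powr (-r) - 1\<bar> \<le> \<bar>- r * ln x\<bar> * (1 + x powr (-r))" unfolding pw by (rule conv)
  also have "\<bar>- r * ln x\<bar> \<le> r * (x + 1 / x)"
    using ln r by (simp add: abs_mult mult_left_mono)
  finally show ?thesis by (simp add: mult_right_mono)
qed


section \<open>Differentiability from difference quotients\<close>

text \<open>Dividing the hypothesis by \<open>h k\<close> shows that the difference quotients form a Cauchy family with
  rate \<open>\<bar>h\<bar> + \<bar>k\<bar>\<close>, so they converge.\<close>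

lemma derivative_of_cauchy_quotients:
  fixes f :: "real \<Rightarrow> real"
  assumes tau: "0 < \<tau>"
    and f: "\<And>h k. \<bar>h\<bar> \<le> \<tau> \<Longrightarrow> \<bar>k\<bar> \<le> \<tau> \<Longrightarrow>
      \<bar>k * (f h - f 0) - h * (f k - f 0)\<bar> \<le> M * (\<bar>h\<bar> * \<bar>k\<bar> * (\<bar>h\<bar> + \<bar>k\<bar>))"
  shows "\<exists>v. (f has_real_derivative v) (at 0)"
proof -
  define g where "g = (\<lambda>h. (f h - f 0) / h)"
  have g: "\<bar>g h - g k\<bar> \<le> M * (\<bar>h\<bar> + \<bar>k\<bar>)" if "\<bar>h\<bar> \<le> \<tau>" "\<bar>k\<bar> \<le> \<tau>" "h \<noteq> 0" "k \<noteq> 0" for h k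
  proof -
    have "\<bar>g h - g k\<bar> * (\<bar>h\<bar> * \<bar>k\<bar>) = \<bar>(g h - g k) * (h * k)\<bar>" by (simp add: abs_mult)
    also have "(g h - g k) * (h * k) = k * (f h - f 0) - h * (f k - f 0)"
      using that by (simp add: g_def field_simps)
    also have "\<bar>\<dots>\<bar> \<le> M * (\<bar>h\<bar> + \<bar>k\<bar>) * (\<bar>h\<bar> * \<bar>k\<bar>)" using f[OF that(1,2)] by (simp add: mult_ac)
    finally show ?thesis using that by (simp add: mult_le_cancel_right)
  qed
  have M: "0 \<le> M" using g[of \<tau> \<tau>] tau by (simp add: zero_le_mult_iff)
  define s where "s = (\<lambda>n::nat. \<tau> / real (Suc n))"
  have s: "0 < s n" "\<bar>s n\<bar> \<le> \<tau>" "s n \<noteq> 0" for n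
    using tau by (auto simp: s_def field_simps)
  have s0: "s \<longlonglongrightarrow> 0" unfolding s_def by real_asymp
  have "Cauchy (\<lambda>n. g (s n))"
  proof (rule metric_CauchyI)
    fix e :: real assume e: "0 < e"
    have "(\<lambda>n. M * s n) \<longlonglongrightarrow> M * 0" by (intro tendsto_intros s0)
    then have "eventually (\<lambda>n. M * s n < e / 2) sequentially"
      using e by (intro order_tendstoD(2)[of _ "M * 0"]) auto
    then obtain N where N: "\<And>n. N \<le> n \<Longrightarrow> M * s n < e / 2" by (auto simp: eventually_sequentially)
    show "\<exists>N. \<forall>m\<ge>N. \<forall>n\<ge>N. dist (g (s m)) (g (s n)) < e"
    proof (intro exI allI impI)
      fix m n assume "N \<le> m" "N \<le> n"
      have "\<bar>g (s m) - g (s n)\<bar> \<le> M * s m + M * s n"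
        using g[of "s m" "s n"] s[of m] s[of n] by (simp add: distrib_left)
      then show "dist (g (s m)) (g (s n)) < e"
        using N[OF \<open>N \<le> m\<close>] N[OF \<open>N \<le> n\<close>] by (simp add: dist_real_def)
    qed
  qed
  then obtain v where v: "(\<lambda>n. g (s n)) \<longlonglongrightarrow> v" using Cauchy_convergent_iff convergent_def by blast
  have gv: "\<bar>g h - v\<bar> \<le> M * \<bar>h\<bar>" if h: "\<bar>h\<bar> \<le> \<tau>" "h \<noteq> 0" for h
  proof (rule tendsto_le[OF trivial_limit_sequentially])
    show "(\<lambda>n. M * (\<bar>h\<bar> + \<bar>s n\<bar>)) \<longlonglongrightarrow> M * \<bar>h\<bar>"
      using tendsto_mult_left[OF tendsto_add[OF tendsto_const tendsto_rabs[OF s0]], of M "\<bar>h\<bar>"] by simp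
    show "(\<lambda>n. \<bar>g h - g (s n)\<bar>) \<longlonglongrightarrow> \<bar>g h - v\<bar>" by (intro tendsto_intros v)
    show "\<forall>\<^sub>F n in sequentially. \<bar>g h - g (s n)\<bar> \<le> M * (\<bar>h\<bar> + \<bar>s n\<bar>)"
      using g h s by simp
  qed
  have "((\<lambda>h. g h - v) \<longlongrightarrow> 0) (at 0)"
  proof (rule Lim_null_comparison)
    have "eventually (\<lambda>h::real. h \<in> {-\<tau><..<\<tau>} \<and> h \<noteq> 0) (at 0)"
      using tau by (intro eventually_conj eventually_at_in_open' eventually_neq_at_within) auto
    then show "\<forall>\<^sub>F h in at 0. norm (g h - v) \<le> M * \<bar>h\<bar>"
      by eventually_elim (auto intro!: gv)
    show "((\<lambda>h. M * \<bar>h\<bar>) \<longlongrightarrow> 0) (at 0)" by (auto intro!: tendsto_eq_intros)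
  qed
  then have "(g \<longlongrightarrow> v) (at 0)" using Lim_null by blast
  then show ?thesis unfolding g_def by (auto simp: DERIV_def intro!: exI[of _ v])
qed

lemma derivative_bound:
  fixes f :: "real \<Rightarrow> real"
  assumes f: "(f has_real_derivative v) (at 0)" and tau: "0 < \<tau>"
    and B: "\<And>h. \<bar>h\<bar> \<le> \<tau> \<Longrightarrow> \<bar>f h - f 0\<bar> \<le> B * \<bar>h\<bar>"
  shows "\<bar>v\<bar> \<le> B"
proof (rule tendsto_upperbound)
  show "((\<lambda>h. \<bar>(f h - f 0) / h\<bar>) \<longlongrightarrow> \<bar>v\<bar>) (at 0)"
    using f by (intro tendsto_rabs) (simp add: DERIV_def)
  have "eventually (\<lambda>h::real. h \<in> {-\<tau><..<\<tau>} \<and> h \<noteq> 0) (at 0)"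
    using tau by (intro eventually_conj eventually_at_in_open' eventually_neq_at_within) auto
  then show "\<forall>\<^sub>F h in at 0. \<bar>(f h - f 0) / h\<bar> \<le> B"
    by eventually_elim (use B in \<open>auto simp: field_simps\<close>)
qed simp

section \<open>The first integral of the profile equation\<close>

text \<open>Below the level \<open>\<eta>\<close> the slope cannot change sign, so once \<open>f\<close> decreases there it keeps
  decreasing at rate at least \<open>e\<close> and becomes negative after a finite time.\<close>

lemma no_transversal_descent:
  fixes f f' :: "real \<Rightarrow> real"
  assumes f: "\<And>x. (f has_real_derivative f' x) (at x)"
    and cont: "continuous_on UNIV f'"
    and pos: "\<And>x. 0 < f x"
    and steep: "\<And>x. f x < \<eta> \<Longrightarrow> e\<^sup>2 \<le> (f' x)\<^sup>2" and e: "0 < e"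
    and x0: "f x0 < \<eta>" "f' x0 < 0"
  shows False
proof -
  have neg: "f' x < 0" if x: "x0 \<le> x" for x
  proof (rule ccontr)
    assume nonneg: "\<not> f' x < 0"
    define S where "S = {x0..x} \<inter> {y. 0 \<le> f' y}"
    have "closed S" unfolding S_def
      by (intro closed_Int closed_Collect_le cont continuous_intros) 
    moreover have "S \<noteq> {}" "bdd_below S" using nonneg x by (auto simp: S_def)
    ultimately have inS: "Inf S \<in> S" and low: "\<And>y. y \<in> S \<Longrightarrow> Inf S \<le> y"
      by (auto intro: closed_contains_Inf cInf_lower)
    define x1 where "x1 = Inf S"
    have x1: "x0 \<le> x1" "x1 \<le> x" "0 \<le> f' x1" using inS by (auto simp: S_def x1_def)
    have lt: "x0 < x1" using x1 x0 by (cases "x0 = x1") auto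
    have before: "f' y < 0" if "x0 \<le> y" "y < x1" for y
      using low[of y] that x1 unfolding S_def x1_def by force
    obtain z where z: "x0 < z" "z < x1" "f x1 - f x0 = (x1 - x0) * f' z"
      using MVT2[OF lt, of f f'] f by auto
    have "(x1 - x0) * f' z < 0" using before[of z] z lt by (intro mult_pos_neg) auto
    then have "f x1 < \<eta>" using z x0 by simp
    from steep[OF this] have "f' x1 \<noteq> 0" using e by auto
    with x1 have "0 < f' x1" by simp
    then obtain y where "x0 \<le> y" "y \<le> x1" "f' y = 0"
      using IVT'[of f' x0 0 x1] lt x0 continuous_on_subset[OF cont] by auto
    with before[of y] \<open>0 < f' x1\<close> show False by (cases "y = x1") auto
  qed
  have small: "f x \<le> f x0" if "x0 \<le> x" for x
    by (rule DERIV_nonpos_imp_nonincreasing[OF that]) (use f neg less_imp_le in blast)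
  have steep': "f' x \<le> - e" if "x0 \<le> x" for x
  proof -
    have "e\<^sup>2 \<le> (- f' x)\<^sup>2" using steep[of x] small[OF that] x0 by simp
    then show ?thesis using power2_le_imp_le[of e "- f' x"] neg[OF that] by linarith
  qed
  \<comment> \<open>After this time a descent at rate e has used up the initial value.\<close>
  define L where "L = f x0 / e"
  have L: "0 < L" using pos e by (simp add: L_def)
  obtain z where z: "x0 < z" "f (x0 + L) - f x0 = (x0 + L - x0) * f' z"
    using MVT2[of x0 "x0 + L" f f'] L f by auto
  have "L * f' z \<le> L * - e" using steep'[of z] z L by (intro mult_left_mono) auto
  then have "f (x0 + L) \<le> 0" using z e by (simp add: L_def)
  with pos[of "x0 + L"] show False by simp
qed

lemma L2_not_bounded_below:
  assumes "L2 f" and e: "0 < \<eta>"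
  shows "\<exists>x. f x < \<eta>"
proof (rule ccontr)
  assume "\<not> ?thesis"
  then have ge: "\<eta> \<le> f x" for x by (meson not_le)
  have sq: "\<eta>\<^sup>2 \<le> (f x)\<^sup>2" for x using ge[of x] e by (intro power_mono) auto
  have "integrable lborel (\<lambda>x::real. \<eta>\<^sup>2)"
  proof (rule Bochner_Integration.integrable_bound)
    show "integrable lborel (\<lambda>x. (f x)\<^sup>2)" using assms(1) by (simp add: L2_def)
  qed (use sq in simp_all)
  then have "\<eta>\<^sup>2 = 0 \<or> emeasure lborel (space (lborel :: real measure)) < \<infinity>"
    by (simp add: integrable_iff_bounded ennreal_mult_less_top) 
  then show False using e by simp
qed

definition energy_potential :: "real \<Rightarrow> real \<Rightarrow> real \<Rightarrow> real \<Rightarrow> real \<Rightarrow> real" where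
  "energy_potential b p A c s
     = A * s\<^sup>2 + c / 4 * s ^ 4 - s ^ 6 / 16 - 2 * b / (p + 2) * s powr (p + 2)"

lemma energy_potential_small:
  assumes "4 \<le> p" "0 \<le> b" "0 < s" "s \<le> 1"
  shows "\<bar>energy_potential b p A c s\<bar> \<le> (\<bar>A\<bar> + \<bar>c\<bar> / 4 + 1 / 16 + 2 * b / (p + 2)) * s"
proof -
  have "s ^ n \<le> s" if "0 < n" for n
    using power_decreasing[of 1 n s] that assms by simp
  then have "\<bar>A * s\<^sup>2\<bar> \<le> \<bar>A\<bar> * s" "\<bar>c / 4 * s ^ 4\<bar> \<le> \<bar>c\<bar> / 4 * s" "\<bar>s ^ 6 / 16\<bar> \<le> s / 16"
    using assms by (auto simp: abs_mult intro!: mult_left_mono)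
  moreover have "s powr (p + 2) \<le> s powr 1" using assms by (intro powr_mono') auto
  then have "2 * b / (p + 2) * s powr (p + 2) \<le> 2 * b / (p + 2) * s"
    using assms by (intro mult_left_mono) auto
  then have "\<bar>2 * b / (p + 2) * s powr (p + 2)\<bar> \<le> 2 * b / (p + 2) * s"
    using assms by simp
  ultimately show ?thesis unfolding energy_potential_def distrib_right by linarith
qed

lemma profile_derivatives:
  assumes "is_profile b p \<omega> c \<phi>"
  shows "(\<phi> has_real_derivative deriv \<phi> x) (at x)"
    and "(deriv \<phi> has_real_derivative
           (\<omega> - c\<^sup>2 / 4) * \<phi> x + c / 2 * \<phi> x ^ 3 - 3 / 16 * \<phi> x ^ 5 - b * \<phi> x powr (p + 1)) (at x)"
    and "deriv \<phi> (- x) = - deriv \<phi> x"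
proof -
  have pos: "0 < \<phi> x" using assms by (simp add: is_profile_def)
  show d: "(\<phi> has_real_derivative deriv \<phi> x) (at x)" for x
    using assms by (simp add: is_profile_def DERIV_deriv_iff_real_differentiable)
  have "deriv (deriv \<phi>) x
      = (\<omega> - c\<^sup>2 / 4) * \<phi> x + c / 2 * \<phi> x ^ 3 - 3 / 16 * \<phi> x ^ 5 - b * \<phi> x powr (p + 1)"
  proof -
    have "- deriv (deriv \<phi>) x + (\<omega> - c\<^sup>2 / 4) * \<phi> x + c / 2 * \<bar>\<phi> x\<bar> ^ 2 * \<phi> x
        - 3 / 16 * \<bar>\<phi> x\<bar> ^ 4 * \<phi> x - b * \<bar>\<phi> x\<bar> powr p * \<phi> x = 0"
      using assms by (simp add: is_profile_def)
    moreover have "\<phi> x powr (p + 1) = \<phi> x powr p * \<phi> x" using pos by (simp add: powr_add)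
    ultimately show ?thesis using abs_of_pos[OF pos] by (simp add: eval_nat_numeral)
  qed
  then show "(deriv \<phi> has_real_derivative
      (\<omega> - c\<^sup>2 / 4) * \<phi> x + c / 2 * \<phi> x ^ 3 - 3 / 16 * \<phi> x ^ 5 - b * \<phi> x powr (p + 1)) (at x)"
    using assms by (metis is_profile_def DERIV_deriv_iff_real_differentiable)
  have "((\<lambda>x. \<phi> (- x)) has_real_derivative - deriv \<phi> (- x)) (at x)"
    by (rule DERIV_cong[OF DERIV_chain2[OF d]]) (auto intro!: derivative_eq_intros)
  moreover have "(\<lambda>x. \<phi> (- x)) = \<phi>" using assms by (auto simp: is_profile_def)
  ultimately have "deriv \<phi> x = - deriv \<phi> (- x)" using DERIV_unique d by metis
  then show "deriv \<phi> (- x) = - deriv \<phi> x" by simp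
qed

text \<open>The quantity \<open>(\<phi>')\<^sup>2 - P(\<phi>)\<close> is a constant \<open>E\<close>, and \<open>P(\<phi>)\<close> is small where \<open>\<phi>\<close> is small; such
  points exist because \<open>\<phi>\<close> is square integrable.  If \<open>E < 0\<close>, the square of \<open>\<phi>'\<close> would be negative
  there.  If \<open>E > 0\<close>, the slope would be bounded away from \<open>0\<close> there, and by evenness the slope is
  negative at such a point or at its mirror image, so \<open>\<phi>\<close> would reach negative values.\<close>

lemma profile_first_integral:
  assumes prof: "is_profile b p \<omega> c \<phi>" and p: "4 \<le> p" and b: "0 \<le> b"
  shows "(deriv \<phi> x)\<^sup>2 = energy_potential b p (\<omega> - c\<^sup>2 / 4) c (\<phi> x)"
proof -
  define A where "A = \<omega> - c\<^sup>2 / 4"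
  note d = profile_derivatives[OF prof, folded A_def]
  have pos: "0 < \<phi> x" for x using prof by (simp add: is_profile_def)
  define E where "E = (\<lambda>x. (deriv \<phi> x)\<^sup>2 - energy_potential b p A c (\<phi> x))"
  have pot: "(energy_potential b p A c has_real_derivative
      2 * A * s + c * s ^ 3 - 3 / 8 * s ^ 5 - 2 * b * s powr (p + 1)) (at s)" if "0 < s" for s
  proof -
    have "((\<lambda>s. s powr (p + 2)) has_real_derivative (p + 2) * s powr (p + 1)) (at s)"
      using that by (auto intro!: derivative_eq_intros simp: add.commute)
    then have "((\<lambda>s. 2 * b / (p + 2) * s powr (p + 2)) has_real_derivative 2 * b * s powr (p + 1)) (at s)"
      by (rule DERIV_cong[OF DERIV_cmult]) (use p in simp)
    moreover have "((\<lambda>s. A * s\<^sup>2 + c / 4 * s ^ 4 - s ^ 6 / 16) has_real_derivative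
        2 * A * s + c * s ^ 3 - 3 / 8 * s ^ 5) (at s)"
      by (auto intro!: derivative_eq_intros)
    ultimately have "((\<lambda>s. A * s\<^sup>2 + c / 4 * s ^ 4 - s ^ 6 / 16 - 2 * b / (p + 2) * s powr (p + 2))
        has_real_derivative 2 * A * s + c * s ^ 3 - 3 / 8 * s ^ 5 - 2 * b * s powr (p + 1)) (at s)"
      by (rule DERIV_diff[rotated])
    moreover have "energy_potential b p A c
        = (\<lambda>s. A * s\<^sup>2 + c / 4 * s ^ 4 - s ^ 6 / 16 - 2 * b / (p + 2) * s powr (p + 2))"
      by (simp add: fun_eq_iff energy_potential_def)
    ultimately show ?thesis by simp
  qed
  have "(E has_real_derivative 0) (at x)" for x
    unfolding E_def
    by (rule DERIV_cong[OF DERIV_diff[OF DERIV_power[OF d(2), of 2] DERIV_chain2[OF pot[OF pos] d(1)]]])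
      (simp add: algebra_simps)
  then have const: "E x = E 0" for x by (intro DERIV_isconst_all) auto
  have "E 0 = 0"
  proof (rule ccontr)
    assume ne: "E 0 \<noteq> 0"
    define M where "M = \<bar>A\<bar> + \<bar>c\<bar> / 4 + 1 / 16 + 2 * b / (p + 2)"
    have M: "0 < M" using p b unfolding M_def by (intro add_nonneg_pos add_pos_nonneg) auto
    define \<eta> where "\<eta> = min 1 (\<bar>E 0\<bar> / (2 * M))"
    have eta: "0 < \<eta>" using ne M by (simp add: \<eta>_def)
    have tiny: "\<bar>energy_potential b p A c (\<phi> x)\<bar> \<le> \<bar>E 0\<bar> / 2" if "\<phi> x < \<eta>" for x
    proof -
      have "\<bar>energy_potential b p A c (\<phi> x)\<bar> \<le> M * \<phi> x"
        unfolding M_def by (rule energy_potential_small) (use p b pos[of x] that \<eta>_def in auto)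
      also have "\<dots> \<le> M * (\<bar>E 0\<bar> / (2 * M))"
        using that M by (intro mult_left_mono) (auto simp: \<eta>_def)
      finally show ?thesis using M by simp
    qed
    obtain x0 where x0: "\<phi> x0 < \<eta>"
      using L2_not_bounded_below[OF _ eta, of \<phi>] prof unfolding is_profile_def H1_def by blast
    have sq: "(deriv \<phi> x)\<^sup>2 = E 0 + energy_potential b p A c (\<phi> x)" for x
      using const[of x] by (simp add: E_def)
    have "0 < E 0" using sq[of x0] tiny[OF x0] ne zero_le_power2[of "deriv \<phi> x0"] by linarith
    then have steep: "(sqrt (E 0 / 2))\<^sup>2 \<le> (deriv \<phi> x)\<^sup>2" if "\<phi> x < \<eta>" for x
      using sq[of x] tiny[OF that] by simp
    have cont: "continuous_on UNIV (deriv \<phi>)"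
      using d(2) by (meson DERIV_isCont continuous_at_imp_continuous_on)
    have ndesc: "\<not> deriv \<phi> x < 0" if "\<phi> x < \<eta>" for x
      using no_transversal_descent[OF d(1) cont pos steep _ that] \<open>0 < E 0\<close> by auto
    have "\<phi> (- x0) = \<phi> x0" using prof by (simp add: is_profile_def)
    then have "deriv \<phi> x0 = 0" using ndesc[OF x0] ndesc[of "- x0"] x0 d(3)[of x0] by simp
    with steep[OF x0] \<open>0 < E 0\<close> show False by simp
  qed
  with const[of x] show ?thesis by (simp add: E_def A_def)
qed

section \<open>The inverse square of a profile\<close>

text \<open>The differential equation for the inverse square together with the first integral at the
  origin.  For \<open>p = 4\<close> both nonlinear powers disappear: the first has the coefficient \<open>0\<close>, the
  second the exponent \<open>0\<close>.\<close>

definition inv_square_profile ::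
    "real \<Rightarrow> real \<Rightarrow> real \<Rightarrow> real \<Rightarrow> (real \<Rightarrow> real) \<Rightarrow> bool" where
  "inv_square_profile b p A c u \<longleftrightarrow>
     (\<forall>x. 0 < u x) \<and> (\<forall>x. u (- x) = u x) \<and>
     4 * A * (u 0)\<^sup>2 + c * u 0 = 1 / 4 + 8 * b / (p + 2) * u 0 powr - (p / 2 - 2) \<and>
     (\<exists>u'. (\<forall>x. (u has_real_derivative u' x) (at x)) \<and> u' 0 = 0 \<and>
        (\<forall>x. (u' has_real_derivative
           4 * A * u x + c / 2 + 2 * b * (p - 4) / (p + 2) * u x powr - (p / 2 - 1)) (at x)))"

text \<open>The second derivative of the inverse square is \<open>- 2 \<phi>'' / \<phi>^3 + 6 (\<phi>')\<^sup>2 / \<phi>^4\<close>.  Inserting the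
  equation for \<open>\<phi>''\<close> and the first integral for \<open>(\<phi>')\<^sup>2\<close>, the contributions of the quintic term
  cancel, and those of the power \<open>p\<close> combine to the factor \<open>p - 4\<close>.\<close>

lemma inv_square_profile:
  assumes prof: "is_profile b p \<omega> c \<phi>" and p: "4 \<le> p" and b: "0 \<le> b"
  shows "inv_square_profile b p (\<omega> - c\<^sup>2 / 4) c (\<lambda>x. 1 / (\<phi> x)\<^sup>2)"
proof -
  define A where "A = \<omega> - c\<^sup>2 / 4"
  note d = profile_derivatives[OF prof, folded A_def]
  note fi = profile_first_integral[OF prof p b, folded A_def]
  have pos: "0 < \<phi> x" for x using prof by (simp add: is_profile_def)
  have ne: "\<phi> x \<noteq> 0" for x using pos[of x] by simp
  define u' where "u' = (\<lambda>x. - 2 * deriv \<phi> x / \<phi> x ^ 3)"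
  have inv: "1 / (\<phi> x)\<^sup>2 = \<phi> x powr - 2" for x
    using pos[of x] by (simp add: powr_minus divide_simps flip: powr_numeral)
  have pw: "(1 / (\<phi> x)\<^sup>2) powr - (p / 2 - 1) = \<phi> x powr (p + 2) / \<phi> x ^ 4"
     "(1 / (\<phi> x)\<^sup>2) powr - (p / 2 - 2) = \<phi> x powr (p + 2) / \<phi> x ^ 6"
     "\<phi> x powr (p + 1) = \<phi> x powr (p + 2) / \<phi> x" for x
  proof -
    have "\<phi> x powr (p - 2) = \<phi> x powr (p + 2) / \<phi> x ^ 4"
      using pos[of x] powr_diff[of "\<phi> x" "p + 2" 4] by simp
    moreover have "\<phi> x powr (p - 4) = \<phi> x powr (p + 2) / \<phi> x ^ 6"
      using pos[of x] powr_diff[of "\<phi> x" "p + 2" 6] by simp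
    ultimately show "(1 / (\<phi> x)\<^sup>2) powr - (p / 2 - 1) = \<phi> x powr (p + 2) / \<phi> x ^ 4"
     "(1 / (\<phi> x)\<^sup>2) powr - (p / 2 - 2) = \<phi> x powr (p + 2) / \<phi> x ^ 6"
      unfolding inv powr_powr by (simp_all add: algebra_simps)
    show "\<phi> x powr (p + 1) = \<phi> x powr (p + 2) / \<phi> x"
      using pos[of x] powr_diff[of "\<phi> x" "p + 2" 1] by (simp add: add.commute)
  qed
  have "((\<lambda>x. 1 / (\<phi> x)\<^sup>2) has_real_derivative u' x) (at x)" for x
    unfolding u'_def
    using ne[of x] by (auto intro!: derivative_eq_intros d(1) simp: divide_simps eval_nat_numeral)
  moreover have "u' 0 = 0" using d(3)[of 0] by (simp add: u'_def)
  moreover have "(u' has_real_derivative 4 * A * (1 / (\<phi> x)\<^sup>2) + c / 2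
      + 2 * b * (p - 4) / (p + 2) * (1 / (\<phi> x)\<^sup>2) powr - (p / 2 - 1)) (at x)" for x
  proof -
    define Y where "Y = \<phi> x powr (p + 2)"
    define s where "s = \<phi> x"
    have s: "s \<noteq> 0" using ne by (simp add: s_def)
    define F where "F = A * s + c / 2 * s ^ 3 - 3 / 16 * s ^ 5 - b * (Y / s)"
    have dF: "(deriv \<phi> has_real_derivative F) (at x)"
      using d(2)[of x] unfolding F_def Y_def s_def pw(3) .
    have "(u' has_real_derivative (- 2 * F * s ^ 3 - (- 2 * deriv \<phi> x) * (3 * s\<^sup>2 * deriv \<phi> x))
        / (s ^ 3 * s ^ 3)) (at x)"
      unfolding u'_def using ne[of x]
      by (intro DERIV_cong[OF DERIV_divide[OF DERIV_cmult[OF dF, of "-2"] DERIV_power[OF d(1), of 3]]])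
        (simp_all add: s_def mult_ac)
    moreover have e1: "(- 2 * F * s ^ 3 - (- 2 * deriv \<phi> x) * (3 * s\<^sup>2 * deriv \<phi> x)) / (s ^ 3 * s ^ 3)
        = - 2 * F / s ^ 3 + 6 * (deriv \<phi> x)\<^sup>2 / s ^ 4"
      using s by (simp add: divide_simps) algebra
    moreover have e2: "- 2 * F / s ^ 3 = - 2 * A / s\<^sup>2 - c + 3 / 8 * s\<^sup>2 + 2 * b * (Y / s ^ 4)"
      using s by (simp add: F_def divide_simps) algebra
    moreover have e3: "6 * (deriv \<phi> x)\<^sup>2 / s ^ 4
        = 6 * A / s\<^sup>2 + 3 / 2 * c - 3 / 8 * s\<^sup>2 - 6 * (2 * b / (p + 2)) * (Y / s ^ 4)"
    proof -
      define k where "k = 2 * b / (p + 2)"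
      show ?thesis
        unfolding fi energy_potential_def k_def[symmetric] Y_def[symmetric]
        unfolding s_def[symmetric]
        using s by (simp add: divide_simps) algebra
    qed
    moreover have e4: "2 * b * (p - 4) / (p + 2) = 2 * b - 6 * (2 * b / (p + 2))"
      using p by (simp add: field_simps)
    moreover have "- 2 * A / s\<^sup>2 - c + 3 / 8 * s\<^sup>2 + 2 * b * (Y / s ^ 4)
        + (6 * A / s\<^sup>2 + 3 / 2 * c - 3 / 8 * s\<^sup>2 - 6 * (2 * b / (p + 2)) * (Y / s ^ 4))
        = 4 * A * (1 / s\<^sup>2) + c / 2 + (2 * b - 6 * (2 * b / (p + 2))) * (Y / s ^ 4)"
      by (simp add: left_diff_distrib diff_divide_distrib)
    ultimately have "(u' has_real_derivative 4 * A * (1 / s\<^sup>2) + c / 2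
        + 2 * b * (p - 4) / (p + 2) * (Y / s ^ 4)) (at x)"
      by (simp only:)
    then show ?thesis unfolding pw Y_def s_def .
  qed
  moreover have "4 * A * (1 / (\<phi> 0)\<^sup>2)\<^sup>2 + c * (1 / (\<phi> 0)\<^sup>2)
      = 1 / 4 + 8 * b / (p + 2) * (1 / (\<phi> 0)\<^sup>2) powr - (p / 2 - 2)"
  proof -
    define Y where "Y = \<phi> 0 powr (p + 2)"
    define s where "s = \<phi> 0"
    have s: "s \<noteq> 0" using ne by (simp add: s_def)
    have "energy_potential b p A c s = 0"
      using fi[of 0] d(3)[of 0] by (simp add: s_def)
    then have "A * s\<^sup>2 + c / 4 * s ^ 4 - s ^ 6 / 16 - 2 * b / (p + 2) * Y = 0"
      unfolding energy_potential_def Y_def s_def .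
    moreover define k where "k = 2 * b / (p + 2)"
    moreover have "4 * A * (1 / s\<^sup>2)\<^sup>2 + c * (1 / s\<^sup>2) - 1 / 4 - 4 * k * (Y / s ^ 6)
        = 4 / s ^ 6 * (A * s\<^sup>2 + c / 4 * s ^ 4 - s ^ 6 / 16 - k * Y)"
      using s by (simp add: divide_simps)
    ultimately show ?thesis
      unfolding pw unfolding Y_def[symmetric] unfolding s_def[symmetric] by simp
  qed
  moreover have "\<phi> (- x) = \<phi> x" for x using prof by (simp add: is_profile_def)
  ultimately show ?thesis
    unfolding inv_square_profile_def A_def[symmetric] using ne by auto
qed

section \<open>Norms of exponentially decaying functions\<close>

text \<open>The two summands used as a majorant are the exponential on the right half-line and its mirror
  image on the left one.\<close>

lemma integrable_exp_minus_abs: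
  assumes "0 < (a::real)"
  shows "integrable lborel (\<lambda>x. exp (- a * \<bar>x\<bar>))"
proof -
  define f where "f = (\<lambda>x::real. x ^ 0 * exp (- x) * indicator {0..} x)"
  have f: "integrable lborel f"
    using integrable.intros[OF has_bochner_integral_I0i_power_exp_m'[of 0]] unfolding f_def .
  have "integrable lborel (\<lambda>x. f (0 + a * x) + f (0 + (- a) * x))"
    using assms by (intro Bochner_Integration.integrable_add lborel_integrable_real_affine f) auto
  then show ?thesis
    by (rule Bochner_Integration.integrable_bound)
      (use assms in \<open>auto simp: f_def indicator_def abs_if mult_le_0_iff zero_le_mult_iff\<close>)
qed

definition L2_decay_const :: "real \<Rightarrow> real" where
  "L2_decay_const \<sigma> = sqrt (\<integral>x. exp (- (2 * \<sigma>) * \<bar>x\<bar>) \<partial>lborel)"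

lemma norms_of_decaying:
  fixes f :: "real \<Rightarrow> real"
  assumes meas: "f \<in> borel_measurable lborel" and \<sigma>: "0 < \<sigma>" and B: "0 \<le> B"
    and f: "\<And>x. \<bar>f x\<bar> \<le> B * exp (- \<sigma> * \<bar>x\<bar>)"
  shows "Linf_norm f \<le> ereal B" "L2_norm f \<le> ereal (B * L2_decay_const \<sigma>)"
proof -
  have "\<bar>f x\<bar> \<le> B" for x
  proof -
    have "B * exp (- \<sigma> * \<bar>x\<bar>) \<le> B * 1" using \<sigma> B by (intro mult_left_mono) auto
    with f[of x] show ?thesis by simp
  qed
  then show "Linf_norm f \<le> ereal B"
    unfolding Linf_norm_def using meas by (intro esssup_I) auto
  define g where "g = (\<lambda>x::real. exp (- (2 * \<sigma>) * \<bar>x\<bar>))"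
  have g: "integrable lborel g" unfolding g_def using \<sigma> by (intro integrable_exp_minus_abs) auto
  have sq: "(f x)\<^sup>2 \<le> B\<^sup>2 * g x" for x
  proof -
    have "(f x)\<^sup>2 \<le> (B * exp (- \<sigma> * \<bar>x\<bar>))\<^sup>2"
      using power_mono[OF f[of x], of 2] by simp
    also have "\<dots> = B\<^sup>2 * g x"
      by (simp add: g_def power_mult_distrib power2_eq_square flip: exp_add)
    finally show ?thesis .
  qed
  have gB: "integrable lborel (\<lambda>x. B\<^sup>2 * g x)" using g by simp
  have int: "integrable lborel (\<lambda>x. (f x)\<^sup>2)"
  proof (rule Bochner_Integration.integrable_bound[OF gB])
    show "AE x in lborel. norm ((f x)\<^sup>2) \<le> norm (B\<^sup>2 * g x)"
      using sq by (simp add: g_def)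
  qed (use meas in measurable)
  have "(\<integral>x. (f x)\<^sup>2 \<partial>lborel) \<le> (\<integral>x. B\<^sup>2 * g x \<partial>lborel)"
    by (rule integral_mono[OF int gB sq])
  then have "sqrt (\<integral>x. (f x)\<^sup>2 \<partial>lborel) \<le> sqrt (B\<^sup>2 * (\<integral>x. g x \<partial>lborel))" by simp
  also have "\<dots> = B * L2_decay_const \<sigma>"
    using B by (simp add: real_sqrt_mult L2_decay_const_def g_def)
  finally show "L2_norm f \<le> ereal (B * L2_decay_const \<sigma>)"
    unfolding L2_norm_def L2_def using meas int by simp
qed

section \<open>Uniform bounds along a curve in parameter space\<close>

text \<open>The inverse squares of the profiles as \<open>(\<omega>, c)\<close> moves along a line with parameter \<open>h\<close>.  The
  coefficient \<open>A = \<omega> - c\<^sup>2 / 4\<close> is then quadratic in \<open>h\<close> and \<open>C\<close>, the parameter \<open>c\<close>, is affine, so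
  one argument covers both partial derivatives.  The size of \<open>\<tau>\<close> keeps \<open>A h\<close> within an eighth of
  \<open>A 0\<close>.\<close>

locale profile_curve =
  fixes b \<alpha>\<^sub>1 \<alpha>\<^sub>2 \<beta> \<tau> :: real and A C :: "real \<Rightarrow> real"
    and U :: "real \<Rightarrow> real \<Rightarrow> real \<Rightarrow> real"
  assumes b: "0 \<le> b" and A0: "0 < A 0" and tau: "0 < \<tau>" "\<tau> \<le> 1"
    and A_eq: "\<And>h. A h = A 0 + \<alpha>\<^sub>1 * h + \<alpha>\<^sub>2 * h\<^sup>2"
    and C_eq: "\<And>h. C h = C 0 + \<beta> * h"
    and tau_small: "8 * (\<bar>\<alpha>\<^sub>1\<bar> + \<bar>\<alpha>\<^sub>2\<bar>) * \<tau> \<le> A 0"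
    and profile: "\<And>p h. 4 \<le> p \<Longrightarrow> \<bar>h\<bar> \<le> \<tau> \<Longrightarrow> inv_square_profile b p (A h) (C h) (U p h)"
begin

text \<open>The coefficients \<open>eps\<close> and \<open>kap\<close> are those of the nonlinear terms; the remaining numbers are
  uniform in \<open>p \<in> {4..5}\<close> and \<open>\<bar>h\<bar> \<le> \<tau>\<close>.  The value at the origin lies
  between \<open>lo\<close> and \<open>hi\<close>; \<open>S\<close> dominates every negative power of \<open>u\<close> that occurs; \<open>\<mu>\<close> is the growth
  exponent, chosen with \<open>4 A h + 9/16 A 0 \<le> \<mu>\<^sup>2\<close>, so that \<open>9/16 A 0\<close> can serve as the gap in
  \<open>growth_bound\<close> throughout; and for \<open>p \<le> 4 + \<delta>\<close> the linearised potentials are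
  nonnegative.\<close>

definition eps :: "real \<Rightarrow> real" where "eps p = 2 * b * (p - 4) / (p + 2)"
definition kap :: "real \<Rightarrow> real" where "kap p = 8 * b / (p + 2)"
definition cmax :: real where "cmax = \<bar>C 0\<bar> + \<bar>\<beta>\<bar>"
definition amax :: real where "amax = \<bar>\<alpha>\<^sub>1\<bar> + \<bar>\<alpha>\<^sub>2\<bar>"
definition lo :: real where "lo = min 1 (1 / (4 * (5 * A 0 + cmax)))"
definition hi :: real where "hi = max 1 ((1 / 4 + 2 * b + cmax) / (2 * A 0))"
definition S :: real where "S = lo powr - 4"
definition \<mu> :: real where "\<mu> = 9 / 4 * sqrt (A 0)"
definition \<delta> :: real where "\<delta> = min 1 (A 0 / ((b + 1) * S))"

lemma cmax_nonneg: "0 \<le> cmax" by (simp add: cmax_def)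

lemma amax_nonneg: "0 \<le> amax" by (simp add: amax_def)

lemma lo: "0 < lo" "lo \<le> 1" using A0 by (auto simp: lo_def cmax_def add_pos_nonneg)
lemma hi: "1 \<le> hi" by (simp add: hi_def)

lemma lo_powr_le_S: "0 \<le> e \<Longrightarrow> e \<le> 4 \<Longrightarrow> lo powr (-e) \<le> S"
  unfolding S_def using lo by (intro powr_mono') auto

lemma S_ge_1: "1 \<le> S" using lo_powr_le_S[of 0] lo by simp

lemma delta: "0 < \<delta>" "\<delta> \<le> 1" using A0 b S_ge_1 by (auto simp: \<delta>_def)

lemma mu: "0 < \<mu>" "\<mu>\<^sup>2 = 81 / 16 * A 0"
  using A0 by (auto simp: \<mu>_def power_mult_distrib power2_eq_square)

lemma exp_mu_ge_1: "0 \<le> x \<Longrightarrow> 1 \<le> exp (\<mu> * x)" using mu by simp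

lemma eps: "4 \<le> p \<Longrightarrow> 0 \<le> eps p" "4 \<le> p \<Longrightarrow> eps p \<le> b / 3 * (p - 4)" "eps 4 = 0"
proof -
  assume p: "4 \<le> p"
  show "0 \<le> eps p" using p b by (simp add: eps_def)
  have "2 * b * (p - 4) / (p + 2) \<le> 2 * b * (p - 4) / 6"
    using p b by (intro divide_left_mono) auto
  then show "eps p \<le> b / 3 * (p - 4)" by (simp add: eps_def)
qed (simp add: eps_def)

lemma eps_le: "4 \<le> p \<Longrightarrow> p \<le> 5 \<Longrightarrow> eps p \<le> b"
  using eps(2)[of p] mult_left_mono[of "p - 4" 1 "b / 3"] b by simp

lemma kap: "4 \<le> p \<Longrightarrow> 0 \<le> kap p" "4 \<le> p \<Longrightarrow> kap p \<le> 2 * b"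
  "4 \<le> p \<Longrightarrow> \<bar>kap p - kap 4\<bar> \<le> b * (p - 4)"
proof -
  assume p: "4 \<le> p"
  show "0 \<le> kap p" using p b by (simp add: kap_def)
  have "8 * b / (p + 2) \<le> 8 * b / 6" using p b by (intro divide_left_mono) auto
  then show "kap p \<le> 2 * b" unfolding kap_def using b by linarith
  have "kap 4 - kap p = 8 * b * (p - 4) / (6 * (p + 2))"
    using p by (simp add: kap_def field_simps)
  also have "\<dots> \<le> 8 * b * (p - 4) / 8" using p b by (intro divide_left_mono) auto
  finally have "kap 4 - kap p \<le> b * (p - 4)" by simp
  moreover have "kap p \<le> kap 4" unfolding kap_def using p b by (intro divide_left_mono) auto
  ultimately show "\<bar>kap p - kap 4\<bar> \<le> b * (p - 4)" by simp
qed

lemma A_diff: assumes "\<bar>h\<bar> \<le> \<tau>" shows "\<bar>A h - A 0\<bar> \<le> amax * \<bar>h\<bar>"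
proof -
  have "h\<^sup>2 \<le> \<bar>h\<bar>" using power_decreasing[of 1 2 "\<bar>h\<bar>"] assms tau by simp
  then have "\<bar>\<alpha>\<^sub>2 * h\<^sup>2\<bar> \<le> \<bar>\<alpha>\<^sub>2\<bar> * \<bar>h\<bar>" by (simp add: abs_mult mult_left_mono)
  moreover have "A h - A 0 = \<alpha>\<^sub>1 * h + \<alpha>\<^sub>2 * h\<^sup>2" using A_eq[of h] by simp
  moreover have "\<bar>\<alpha>\<^sub>1 * h\<bar> = \<bar>\<alpha>\<^sub>1\<bar> * \<bar>h\<bar>" by (rule abs_mult)
  ultimately show ?thesis unfolding amax_def distrib_right by linarith
qed

lemma A_bounds: assumes "\<bar>h\<bar> \<le> \<tau>" shows "7 / 8 * A 0 \<le> A h" "A h \<le> 9 / 8 * A 0"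
proof -
  have "amax * \<bar>h\<bar> \<le> amax * \<tau>" using assms amax_nonneg by (intro mult_left_mono) auto
  with A_diff[OF assms] tau_small[folded amax_def] have "\<bar>A h - A 0\<bar> \<le> A 0 / 8" by linarith
  then show "7 / 8 * A 0 \<le> A h" "A h \<le> 9 / 8 * A 0" by linarith+
qed

lemma C_diff: "C h - C 0 = \<beta> * h" using C_eq[of h] by simp

lemma C_bound: assumes "\<bar>h\<bar> \<le> \<tau>" shows "\<bar>C h\<bar> \<le> cmax"
proof -
  have "\<bar>\<beta> * h\<bar> \<le> \<bar>\<beta>\<bar> * 1" unfolding abs_mult using assms tau by (intro mult_left_mono) auto
  then show ?thesis using C_diff[of h] unfolding cmax_def by linarith
qed

lemma U_pos: "4 \<le> p \<Longrightarrow> \<bar>h\<bar> \<le> \<tau> \<Longrightarrow> 0 < U p h x"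
  using profile[of p h] by (simp add: inv_square_profile_def)

lemma U_abs: "4 \<le> p \<Longrightarrow> \<bar>h\<bar> \<le> \<tau> \<Longrightarrow> U p h \<bar>x\<bar> = U p h x"
  using profile[of p h] by (simp add: inv_square_profile_def abs_if)

lemma U_center:
  "4 \<le> p \<Longrightarrow> \<bar>h\<bar> \<le> \<tau> \<Longrightarrow>
     4 * A h * (U p h 0)\<^sup>2 + C h * U p h 0 = 1 / 4 + kap p * U p h 0 powr - (p / 2 - 2)"
  using profile[of p h] by (simp add: inv_square_profile_def kap_def)

lemma U_derivs:
  assumes "4 \<le> p" "\<bar>h\<bar> \<le> \<tau>"
  obtains u' where "\<And>x. (U p h has_real_derivative u' x) (at x)" "u' 0 = 0"
    "\<And>x. (u' has_real_derivative
           4 * A h * U p h x + C h / 2 + eps p * U p h x powr - (p / 2 - 1)) (at x)"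
  using profile[OF assms] unfolding inv_square_profile_def eps_def by blast

text \<open>Both bounds come from the equation at the origin: its right-hand side is at least \<open>1/4\<close>, which
  excludes small values, and at most \<open>1/4 + 2 b\<close> when the value exceeds \<open>1\<close>, which excludes
  large ones.\<close>

lemma center_bounds:
  assumes p: "4 \<le> p" "p \<le> 5" and h: "\<bar>h\<bar> \<le> \<tau>"
  shows "lo \<le> U p h 0" "U p h 0 \<le> hi"
proof -
  define m where "m = U p h 0"
  have m: "0 < m" using U_pos p h by (simp add: m_def)
  have eq: "4 * A h * m\<^sup>2 + C h * m = 1 / 4 + kap p * m powr - (p / 2 - 2)"
    using U_center[OF p(1) h] by (simp add: m_def)
  note Ab = A_bounds[OF h] and Cb = C_bound[OF h]
  have cm: "\<bar>C h * m\<bar> \<le> cmax * m" unfolding abs_mult using Cb m by (intro mult_mono) auto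
  have "lo \<le> m"
  proof (cases "1 \<le> m")
    case True then show ?thesis using lo by simp
  next
    case False
    have "1 / 4 \<le> 4 * A h * m\<^sup>2 + C h * m"
      using eq kap(1)[OF p(1)] by simp
    also have "4 * A h * m\<^sup>2 \<le> 5 * A 0 * m"
    proof -
      have "4 * A h * m\<^sup>2 \<le> 5 * A 0 * (m * 1)"
        unfolding power2_eq_square
        by (rule mult_mono[OF _ mult_left_mono]) (use Ab A0 False m in auto)
      then show ?thesis by simp
    qed
    finally have "1 / 4 \<le> (5 * A 0 + cmax) * m" using cm unfolding distrib_right by linarith
    moreover have "0 < 5 * A 0 + cmax" using A0 by (simp add: cmax_def add_pos_nonneg)
    ultimately have "1 / (4 * (5 * A 0 + cmax)) \<le> m" by (simp add: field_simps)
    then show ?thesis by (simp add: lo_def)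
  qed
  then show "lo \<le> U p h 0" by (simp add: m_def)
  have "m \<le> hi"
  proof (cases "m \<le> 1")
    case True then show ?thesis using hi by simp
  next
    case False
    have "m powr - (p / 2 - 2) \<le> m powr 0" using p False by (intro powr_mono) auto
    then have "m powr - (p / 2 - 2) \<le> 1" using m by simp
    then have "kap p * m powr - (p / 2 - 2) \<le> 2 * b * 1"
      using kap[OF p(1)] b by (intro mult_mono) auto
    then have "4 * A h * m\<^sup>2 \<le> 1 / 4 * 1 + 2 * b * 1 + cmax * m" using eq cm by linarith
    also have "\<dots> \<le> 1 / 4 * m + 2 * b * m + cmax * m"
      using False b cmax_nonneg by (intro add_mono mult_left_mono) auto
    finally have "4 * A h * m * m \<le> (1 / 4 + 2 * b + cmax) * m"
      by (simp add: algebra_simps power2_eq_square)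
    then have "4 * A h * m \<le> 1 / 4 + 2 * b + cmax" using m by simp
    moreover have "2 * A 0 * m \<le> 4 * A h * m" using Ab A0 m by (intro mult_right_mono) auto
    ultimately have "m \<le> (1 / 4 + 2 * b + cmax) / (2 * A 0)" using A0 by (simp add: field_simps)
    then show ?thesis by (simp add: hi_def)
  qed
  then show "U p h 0 \<le> hi" by (simp add: m_def)
qed

text \<open>This is the uniform nondegeneracy of the equation for the value at the origin: its left-hand
  side \<open>4 A m\<^sup>2 + C m = (4 A m + C) m\<close> is at least \<open>1/4\<close>.\<close>

lemma center_coercive:
  assumes p: "4 \<le> p" "p \<le> 5" and h: "\<bar>h\<bar> \<le> \<tau>"
  shows "1 / (4 * hi) \<le> 4 * A h * U p h 0 + C h"
proof -
  define m where "m = U p h 0"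
  have m: "0 < m" "m \<le> hi" using U_pos p h center_bounds[OF p h] by (auto simp: m_def)
  have "1 / 4 \<le> (4 * A h * m + C h) * m"
    using U_center[OF p(1) h] kap(1)[OF p(1)]
    by (simp add: m_def power2_eq_square algebra_simps)
  then have "1 / (4 * m) \<le> 4 * A h * m + C h" using m by (simp add: field_simps)
  moreover have "1 / (4 * hi) \<le> 1 / (4 * m)" using m by (intro divide_left_mono) auto
  ultimately show ?thesis by (simp add: m_def)
qed

lemma coercive_bound:
  assumes "1 / (4 * hi) \<le> g" "\<bar>g * w\<bar> \<le> B"
  shows "\<bar>w\<bar> \<le> 4 * hi * B"
proof -
  have g: "0 < 1 / (4 * hi)" using hi by simp
  have "1 / (4 * hi) * \<bar>w\<bar> \<le> \<bar>g\<bar> * \<bar>w\<bar>" using assms(1) by (intro mult_right_mono) auto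
  then have "1 / (4 * hi) * \<bar>w\<bar> \<le> B" using assms(2) by (simp add: abs_mult)
  then show ?thesis using hi by (simp add: field_simps)
qed

text \<open>The left-hand side is dominated by the solution of the linear equation without the nonlinear
  term, which only pushes \<open>u\<close> upwards.  That solution grows because its second derivative at the
  origin is bounded below by the coercivity at the origin.\<close>

lemma U_lower:
  assumes p: "4 \<le> p" "p \<le> 5" and h: "\<bar>h\<bar> \<le> \<tau>" and x: "0 \<le> x"
  defines "l \<equiv> 2 * sqrt (A h)"
  shows "U p h 0 + (1 / (8 * hi)) / l\<^sup>2 * (cosh (l * x) - 1) \<le> U p h x"
proof -
  define m where "m = U p h 0"
  define \<sigma> where "\<sigma> = 4 * A h * m + C h / 2"
  have Ah: "0 < A h" using A_bounds[OF h] A0 by linarith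
  have l: "0 < l" "l\<^sup>2 = 4 * A h" using Ah by (auto simp: l_def power_mult_distrib)
  obtain u' where u': "\<And>x. (U p h has_real_derivative u' x) (at x)" "u' 0 = 0"
    "\<And>x. (u' has_real_derivative
           4 * A h * U p h x + C h / 2 + eps p * U p h x powr - (p / 2 - 1)) (at x)"
    using U_derivs[OF p(1) h] by blast
  have "0 < m" using U_pos p h by (simp add: m_def)
  then have "0 \<le> 4 * A h * m" using Ah by simp
  then have sig: "1 / (8 * hi) \<le> \<sigma>"
    using center_coercive[OF p h] unfolding \<sigma>_def m_def by linarith
  have "0 \<le> U p h x - (m + \<sigma> / l\<^sup>2 * (cosh (l * x) - 1))"
  proof (rule comparison_nonneg[where D = "\<lambda>x. U p h x - (m + \<sigma> / l\<^sup>2 * (cosh (l * x) - 1))"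
        and D' = "\<lambda>x. u' x - \<sigma> / l\<^sup>2 * (l * sinh (l * x))"
        and D'' = "\<lambda>x. 4 * A h * U p h x + C h / 2 + eps p * U p h x powr - (p / 2 - 1)
                        - \<sigma> / l\<^sup>2 * (l * (l * cosh (l * x)))" and l = l])
    show "l\<^sup>2 * (U p h x - (m + \<sigma> / l\<^sup>2 * (cosh (l * x) - 1)))
      \<le> 4 * A h * U p h x + C h / 2 + eps p * U p h x powr - (p / 2 - 1)
                        - \<sigma> / l\<^sup>2 * (l * (l * cosh (l * x)))" for x
    proof -
      have "l\<^sup>2 * (U p h x - (m + \<sigma> / l\<^sup>2 * (cosh (l * x) - 1)))
          = 4 * A h * U p h x - 4 * A h * m - \<sigma> * (cosh (l * x) - 1)"
        unfolding l(2) using Ah by (simp add: field_simps)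
      moreover have "\<sigma> / l\<^sup>2 * (l * (l * cosh (l * x))) = \<sigma> * cosh (l * x)"
        using l(1) by (simp add: power2_eq_square)
      moreover have "0 \<le> eps p * U p h x powr - (p / 2 - 1)" using eps(1)[OF p(1)] by simp
      moreover have "\<sigma> * (cosh (l * x) - 1) = \<sigma> * cosh (l * x) - (4 * A h * m + C h / 2)"
        unfolding right_diff_distrib by (simp add: \<sigma>_def)
      ultimately show ?thesis by linarith
    qed
  qed (use u' l x in \<open>auto intro!: derivative_eq_intros u' simp: m_def\<close>)
  moreover have "(1 / (8 * hi)) / l\<^sup>2 * (cosh (l * x) - 1) \<le> \<sigma> / l\<^sup>2 * (cosh (l * x) - 1)"
    using sig cosh_real_ge_1[of "l * x"] by (intro mult_right_mono divide_right_mono) auto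
  ultimately show ?thesis unfolding m_def by linarith
qed

lemma U_ge_lo:
  assumes p: "4 \<le> p" "p \<le> 5" and h: "\<bar>h\<bar> \<le> \<tau>"
  shows "lo \<le> U p h x"
proof -
  have "0 \<le> (1 / (8 * hi)) / (2 * sqrt (A h))\<^sup>2 * (cosh (2 * sqrt (A h) * \<bar>x\<bar>) - 1)"
    using hi cosh_real_ge_1[of "2 * sqrt (A h) * \<bar>x\<bar>"] by (intro mult_nonneg_nonneg) auto
  then have "lo \<le> U p h \<bar>x\<bar>"
    using U_lower[OF p h, of "\<bar>x\<bar>"] center_bounds(1)[OF p h] by simp
  then show ?thesis using U_abs p h by simp
qed

lemma U_exp_lower:
  "\<exists>k>0. \<forall>p\<in>{4..5}. \<forall>x\<ge>0. k * exp (2 * sqrt (A 0) * x) \<le> U p 0 x"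
proof (intro exI conjI ballI allI impI)
  \<comment> \<open>The lower bound is at least min lo s times cosh y, and cosh y is at least half of exp y.\<close>
  define s where "s = (1 / (8 * hi)) / (2 * sqrt (A 0))\<^sup>2"
  have s: "0 < s" using hi A0 by (simp add: s_def)
  show "0 < min lo s / 2" using s lo by simp
  fix p x :: real assume "p \<in> {4..5}" and x: "0 \<le> x"
  then have p: "4 \<le> p" "p \<le> 5" by auto
  define y where "y = 2 * sqrt (A 0) * x"
  have "min lo s / 2 * exp y \<le> min lo s * cosh y"
    using s lo by (auto simp: cosh_def min_def)
  also have "\<dots> = min lo s + min lo s * (cosh y - 1)" by (simp add: algebra_simps)
  also have "\<dots> \<le> lo + s * (cosh y - 1)"
    using cosh_real_ge_1[of y] by (intro add_mono mult_right_mono) auto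
  also have "\<dots> \<le> U p 0 x"
    using U_lower[OF p _ x, of 0] center_bounds(1)[OF p, of 0] tau unfolding s_def y_def by simp
  finally show "min lo s / 2 * exp (2 * sqrt (A 0) * x) \<le> U p 0 x" by (simp add: y_def)
qed

lemma U_powr_le_S:
  assumes p: "4 \<le> p" "p \<le> 5" and h: "\<bar>h\<bar> \<le> \<tau>" and e: "0 \<le> e" "e \<le> 4"
  shows "U p h x powr (-e) \<le> S"
proof -
  have "U p h x powr (-e) \<le> lo powr (-e)" using lo U_ge_lo[OF p h] e by (intro powr_mono2') auto
  also have "\<dots> \<le> S" by (rule lo_powr_le_S[OF e])
  finally show ?thesis .
qed

lemma U_exp_upper:
  "\<exists>K\<ge>0. \<forall>p\<in>{4..5}. \<forall>h\<in>{-\<tau>..\<tau>}. \<forall>x\<ge>0. U p h x \<le> K * exp (\<mu> * x)"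
proof (intro exI conjI ballI allI impI)
  define R where "R = cmax / 2 + b * S"
  have R: "0 \<le> R" using b S_ge_1 by (simp add: R_def cmax_def)
  show "0 \<le> hi + R / (9 / 16 * A 0)" using hi R A0 by simp
  fix p h x :: real assume "p \<in> {4..5}" "h \<in> {-\<tau>..\<tau>}" and x: "0 \<le> x"
  then have p: "4 \<le> p" "p \<le> 5" and h: "\<bar>h\<bar> \<le> \<tau>" by auto
  obtain u' where u': "\<And>x. (U p h has_real_derivative u' x) (at x)" "u' 0 = 0"
    "\<And>x. (u' has_real_derivative
           4 * A h * U p h x + C h / 2 + eps p * U p h x powr - (p / 2 - 1)) (at x)"
    using U_derivs[OF p(1) h] by blast
  have "\<bar>U p h x\<bar> \<le> (hi + R / (9 / 16 * A 0)) * exp (\<mu> * x)"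
  proof (rule growth_bound[where z = "U p h" and z' = u' and Q = "\<lambda>_. 4 * A h"
        and r = "\<lambda>x. C h / 2 + eps p * U p h x powr - (p / 2 - 1)"])
    show "\<bar>C h / 2 + eps p * U p h x powr - (p / 2 - 1)\<bar> \<le> R * exp (\<mu> * x)" if "0 \<le> x" for x
    proof -
      have "eps p * U p h x powr - (p / 2 - 1) \<le> b * S"
        using eps_le[OF p] eps(1)[OF p(1)] U_powr_le_S[OF p h, of "p / 2 - 1"] p b
        by (intro mult_mono) auto
      moreover have "0 \<le> eps p * U p h x powr - (p / 2 - 1)" using eps(1)[OF p(1)] by simp
      ultimately have "\<bar>C h / 2 + eps p * U p h x powr - (p / 2 - 1)\<bar> \<le> R"
        using C_bound[OF h] unfolding R_def by linarith
      also have "\<dots> \<le> R * exp (\<mu> * x)" using mult_left_mono[OF exp_mu_ge_1[OF that] R] by simp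
      finally show ?thesis .
    qed
    show "4 * A h + 9 / 16 * A 0 \<le> \<mu>\<^sup>2" unfolding mu(2) using A_bounds[OF h] by linarith
    show "0 \<le> 4 * A h" using A_bounds[OF h] A0 by linarith
    show "\<bar>U p h 0\<bar> \<le> hi" using U_pos[OF p(1) h, of 0] center_bounds[OF p h] by simp
  qed (use u' mu A0 x in \<open>auto simp: add.assoc\<close>)
  then show "U p h x \<le> (hi + R / (9 / 16 * A 0)) * exp (\<mu> * x)" by simp
qed

section \<open>Dependence on the exponent and on the curve parameter\<close>

lemma delta_p: "p \<le> 4 + \<delta> \<Longrightarrow> p \<le> 5" using delta by simp

text \<open>This is the purpose of the choice of \<open>\<delta>\<close>: the nonlinear term changes the potential \<open>4 A\<close> by at
  most \<open>A\<close>.\<close>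

lemma eps_small:
  assumes p: "4 \<le> p" "p \<le> 4 + \<delta>"
  shows "eps p * (3 / 2 * S) \<le> A 0"
proof -
  have "p - 4 \<le> A 0 / ((b + 1) * S)" using p by (simp add: \<delta>_def)
  then have "(p - 4) * ((b + 1) * S) \<le> A 0"
    using b S_ge_1 by (simp add: pos_le_divide_eq)
  moreover have "b / 3 * (p - 4) * (3 / 2 * S) \<le> (p - 4) * ((b + 1) * S)"
  proof -
    have "b / 2 * ((p - 4) * S) \<le> (b + 1) * ((p - 4) * S)"
      using p b S_ge_1 by (intro mult_right_mono) auto
    then show ?thesis by (simp add: mult_ac)
  qed
  moreover have "eps p * (3 / 2 * S) \<le> b / 3 * (p - 4) * (3 / 2 * S)"
    using eps(2)[OF p(1)] S_ge_1 by (intro mult_right_mono) auto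
  ultimately show ?thesis by linarith
qed

lemma U_slope:
  assumes p: "4 \<le> p" "p \<le> 5" and h: "\<bar>h\<bar> \<le> \<tau>"
  shows "\<exists>V. 0 \<le> V \<and> V \<le> 3 / 2 * S \<and>
    U p h x powr - (p / 2 - 1) - U p 0 x powr - (p / 2 - 1) = - V * (U p h x - U p 0 x)"
proof -
  have 0: "\<bar>0\<bar> \<le> \<tau>" using tau by simp
  obtain V where V: "0 \<le> V" "V \<le> (p / 2 - 1) * lo powr (- (p / 2 - 1) - 1)"
    "U p h x powr - (p / 2 - 1) - U p 0 x powr - (p / 2 - 1) = - V * (U p h x - U p 0 x)"
    using powr_neg_slope[OF lo(1) U_ge_lo[OF p h] U_ge_lo[OF p 0], of "p / 2 - 1"] p by auto
  have e: "- (p / 2 - 1) - 1 = - (p / 2)" by simp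
  have "(p / 2 - 1) * lo powr (- (p / 2 - 1) - 1) \<le> 3 / 2 * S"
    unfolding e using p by (intro mult_mono lo_powr_le_S) auto
  with V show ?thesis by (intro exI[of _ V]) auto
qed

lemma U_taylor:
  assumes p: "4 \<le> p" "p \<le> 5" and h: "\<bar>h\<bar> \<le> \<tau>"
  shows "\<bar>U p h x powr - (p / 2 - 1) - U p 0 x powr - (p / 2 - 1)
           + (p / 2 - 1) * U p 0 x powr - (p / 2) * (U p h x - U p 0 x)\<bar>
         \<le> 4 * S * (U p h x - U p 0 x)\<^sup>2"
proof -
  have 0: "\<bar>0\<bar> \<le> \<tau>" using tau by simp
  have e: "- (p / 2 - 1) - 1 = - (p / 2)" "- (p / 2 - 1) - 2 = - (p / 2 + 1)" by simp_all
  have "(p / 2 - 1) * (p / 2 - 1 + 1) \<le> 3 / 2 * (5 / 2)" using p by (intro mult_mono) auto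
  then have "(p / 2 - 1) * (p / 2 - 1 + 1) \<le> 4" by linarith
  then have "(p / 2 - 1) * (p / 2 - 1 + 1) * lo powr - (p / 2 + 1) \<le> 4 * S"
    by (rule mult_mono[OF _ lo_powr_le_S]) (use p in auto)
  then have "(p / 2 - 1) * (p / 2 - 1 + 1) * lo powr - (p / 2 + 1) * (U p h x - U p 0 x)\<^sup>2
      \<le> 4 * S * (U p h x - U p 0 x)\<^sup>2"
    by (intro mult_right_mono) auto
  then show ?thesis
    using powr_neg_taylor[OF lo(1) U_ge_lo[OF p h, of x] U_ge_lo[OF p 0, of x], of "p / 2 - 1"] p
    unfolding e by linarith
qed

lemma center_slope:
  assumes p: "4 \<le> p" "p \<le> 5" and h: "\<bar>h\<bar> \<le> \<tau>"
  shows "\<exists>V. 0 \<le> V \<and> V \<le> (p - 4) / 2 * S \<and>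
    U p h 0 powr - (p / 2 - 2) - U p 0 0 powr - (p / 2 - 2) = - V * (U p h 0 - U p 0 0)"
proof -
  have 0: "\<bar>0\<bar> \<le> \<tau>" using tau by simp
  obtain V where V: "0 \<le> V" "V \<le> (p / 2 - 2) * lo powr (- (p / 2 - 2) - 1)"
    "U p h 0 powr - (p / 2 - 2) - U p 0 0 powr - (p / 2 - 2) = - V * (U p h 0 - U p 0 0)"
    using powr_neg_slope[OF lo(1) U_ge_lo[OF p h] U_ge_lo[OF p 0], of "p / 2 - 2"] p by auto
  have e: "- (p / 2 - 2) - 1 = - (p / 2 - 1)" "(p - 4) / 2 = p / 2 - 2" by (simp_all add: field_simps)
  have "(p / 2 - 2) * lo powr (- (p / 2 - 2) - 1) \<le> (p - 4) / 2 * S"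
    unfolding e using p by (intro mult_left_mono lo_powr_le_S) auto
  with V show ?thesis by (intro exI[of _ V]) auto
qed

lemma center_taylor:
  assumes p: "4 \<le> p" "p \<le> 5" and h: "\<bar>h\<bar> \<le> \<tau>"
  shows "\<bar>U p h 0 powr - (p / 2 - 2) - U p 0 0 powr - (p / 2 - 2)
           + (p / 2 - 2) * U p 0 0 powr - (p / 2 - 1) * (U p h 0 - U p 0 0)\<bar>
         \<le> S * (U p h 0 - U p 0 0)\<^sup>2"
proof -
  have 0: "\<bar>0\<bar> \<le> \<tau>" using tau by simp
  have e: "- (p / 2 - 2) - 1 = - (p / 2 - 1)" "- (p / 2 - 2) - 2 = - (p / 2)" by simp_all
  have "(p / 2 - 2) * (p / 2 - 2 + 1) \<le> 1 / 2 * (3 / 2)" using p by (intro mult_mono) auto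
  then have "(p / 2 - 2) * (p / 2 - 2 + 1) \<le> 1" by linarith
  then have "(p / 2 - 2) * (p / 2 - 2 + 1) * lo powr - (p / 2) \<le> 1 * S"
    by (rule mult_mono[OF _ lo_powr_le_S]) (use p in auto)
  then have "(p / 2 - 2) * (p / 2 - 2 + 1) * lo powr - (p / 2) * (U p h 0 - U p 0 0)\<^sup>2
      \<le> 1 * S * (U p h 0 - U p 0 0)\<^sup>2"
    by (intro mult_right_mono) auto
  then show ?thesis
    using powr_neg_taylor[OF lo(1) U_ge_lo[OF p h, of 0] U_ge_lo[OF p 0, of 0], of "p / 2 - 2"] p
    unfolding e by linarith
qed

lemma center_p_diff:
  "\<exists>K\<ge>0. \<forall>p\<in>{4..5}. \<forall>h\<in>{-\<tau>..\<tau>}. \<bar>U p h 0 - U 4 h 0\<bar> \<le> K * (p - 4)"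
proof (intro exI conjI ballI)
  \<comment> \<open>The two summands bound the change of the coefficient kap and of the power, respectively.\<close>
  define B where "B = b * S + b * ((hi + 1 / lo) * (1 + S))"
  show "0 \<le> 4 * hi * B" using b S_ge_1 hi lo by (simp add: B_def)
  fix p h :: real assume "p \<in> {4..5}" "h \<in> {-\<tau>..\<tau>}"
  then have p: "4 \<le> p" "p \<le> 5" and h: "\<bar>h\<bar> \<le> \<tau>" by auto
  define m where "m = U p h 0"
  define n where "n = U 4 h 0"
  have m: "lo \<le> m" "m \<le> hi" "0 < m"
    using center_bounds[OF p h] U_pos[OF p(1) h] by (auto simp: m_def)
  have n: "0 < n" using U_pos[of 4 h 0] h by (auto simp: n_def)
  define r where "r = p / 2 - 2"
  have r: "0 \<le> r" "r \<le> 1 / 2" "r = (p - 4) / 2" using p by (auto simp: r_def field_simps)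
  have eqm: "4 * A h * m\<^sup>2 + C h * m = 1 / 4 + kap p * m powr - r"
    using U_center[OF p(1) h] by (simp add: m_def r_def)
  have eqn: "4 * A h * n\<^sup>2 + C h * n = 1 / 4 + kap 4"
    using U_center[of 4 h] h n by (simp add: n_def)
  have mS: "m powr - r \<le> S" using U_powr_le_S[OF p h, of r 0] r(1,2) by (simp add: m_def)
  have "(4 * A h * n + C h + 4 * A h * m) * (m - n) = kap p * m powr - r - kap 4"
    using eqm eqn by (simp add: algebra_simps power2_eq_square)
  also have "\<dots> = (kap p - kap 4) * m powr - r + kap 4 * (m powr - r - 1)"
    by (simp add: algebra_simps)
  finally have eq: "(4 * A h * n + C h + 4 * A h * m) * (m - n)
    = (kap p - kap 4) * m powr - r + kap 4 * (m powr - r - 1)" .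
  have b1: "\<bar>(kap p - kap 4) * m powr - r\<bar> \<le> b * (p - 4) * S"
    unfolding abs_mult using kap(3)[OF p(1)] mS b p by (intro mult_mono) auto
  have "\<bar>m powr - r - 1\<bar> \<le> r * (m + 1 / m) * (1 + m powr - r)"
    by (rule powr_neg_minus_one_bound[OF m(3) r(1)])
  also have "\<dots> \<le> r * (hi + 1 / lo) * (1 + S)"
  proof -
    have "1 / m \<le> 1 / lo" using m lo by (intro divide_left_mono) auto
    then show ?thesis using m mS r(1,2) lo hi by (intro mult_mono add_mono mult_nonneg_nonneg) auto
  qed
  finally have "\<bar>kap 4 * (m powr - r - 1)\<bar> \<le> 2 * b * (r * (hi + 1 / lo) * (1 + S))"
    unfolding abs_mult using kap[of 4] b by (intro mult_mono) auto
  then have b2: "\<bar>kap 4 * (m powr - r - 1)\<bar> \<le> b * ((hi + 1 / lo) * (1 + S)) * (p - 4)"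
    unfolding r(3) by (simp add: mult_ac)
  have "\<bar>(4 * A h * n + C h + 4 * A h * m) * (m - n)\<bar> \<le> B * (p - 4)"
  proof -
    have "B * (p - 4) = b * (p - 4) * S + b * ((hi + 1 / lo) * (1 + S)) * (p - 4)"
      unfolding B_def distrib_right[of _ _ "p - 4"] by (simp only: mult_ac)
    then show ?thesis unfolding eq using b1 b2 by linarith
  qed
  moreover have "1 / (4 * hi) \<le> 4 * A h * n + C h + 4 * A h * m"
  proof -
    have "0 \<le> 4 * A h * m" using A_bounds[OF h] A0 m by simp
    moreover have "1 / (4 * hi) \<le> 4 * A h * n + C h"
      using center_coercive[of 4 h] h unfolding n_def by simp
    ultimately show ?thesis by linarith
  qed
  ultimately have "\<bar>m - n\<bar> \<le> 4 * hi * (B * (p - 4))" by (intro coercive_bound)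
  then show "\<bar>U p h 0 - U 4 h 0\<bar> \<le> 4 * hi * B * (p - 4)" by (simp add: m_def n_def mult_ac)
qed

text \<open>Both functions solve the same linear equation up to the term with the coefficient \<open>eps p\<close>, which
  vanishes at \<open>p = 4\<close> and is \<open>O(p - 4)\<close> because \<open>u\<close> is bounded below.\<close>

lemma U_p_diff:
  "\<exists>K\<ge>0. \<forall>p\<in>{4..5}. \<forall>h\<in>{-\<tau>..\<tau>}. \<forall>x\<ge>0.
     \<bar>U p h x - U 4 h x\<bar> \<le> K * (p - 4) * exp (\<mu> * x)"
proof -
  obtain K0 where K0: "0 \<le> K0"
    "\<And>p h. p \<in> {4..5} \<Longrightarrow> h \<in> {-\<tau>..\<tau>} \<Longrightarrow> \<bar>U p h 0 - U 4 h 0\<bar> \<le> K0 * (p - 4)"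
    using center_p_diff by blast
  show ?thesis
  proof (intro exI conjI ballI allI impI)
    define d where "d = 9 / 16 * A 0"
    have d: "0 < d" using A0 by (simp add: d_def)
    show "0 \<le> K0 + b / 3 * S / d" using K0 b S_ge_1 d by simp
    fix p h x :: real assume ph: "p \<in> {4..5}" "h \<in> {-\<tau>..\<tau>}" and x: "(0::real) \<le> x"
    then have p: "4 \<le> p" "p \<le> 5" and h: "\<bar>h\<bar> \<le> \<tau>" by auto
    obtain u' where u': "\<And>x. (U p h has_real_derivative u' x) (at x)" "u' 0 = 0"
      "\<And>x. (u' has_real_derivative
             4 * A h * U p h x + C h / 2 + eps p * U p h x powr - (p / 2 - 1)) (at x)"
      using U_derivs[OF p(1) h] by blast
    obtain v' where v': "\<And>x. (U 4 h has_real_derivative v' x) (at x)" "v' 0 = 0"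
      "\<And>x. (v' has_real_derivative
             4 * A h * U 4 h x + C h / 2 + eps 4 * U 4 h x powr - (4 / 2 - 1)) (at x)"
      using U_derivs[of 4 h] h by auto
    have "\<bar>U p h x - U 4 h x\<bar> \<le> (K0 * (p - 4) + b / 3 * (p - 4) * S / d) * exp (\<mu> * x)"
    proof (rule growth_bound[where z = "\<lambda>x. U p h x - U 4 h x" and z' = "\<lambda>x. u' x - v' x"
          and Q = "\<lambda>_. 4 * A h" and r = "\<lambda>x. eps p * U p h x powr - (p / 2 - 1)"])
      show "((\<lambda>x. U p h x - U 4 h x) has_real_derivative u' x - v' x) (at x)" for x
        by (intro DERIV_diff u' v')
      show "((\<lambda>x. u' x - v' x) has_real_derivative
          4 * A h * (U p h x - U 4 h x) + eps p * U p h x powr - (p / 2 - 1)) (at x)" for x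
        by (rule DERIV_cong[OF DERIV_diff[OF u'(3) v'(3)]]) (simp add: eps(3) algebra_simps)
      show "\<bar>eps p * U p h x powr - (p / 2 - 1)\<bar> \<le> b / 3 * (p - 4) * S * exp (\<mu> * x)"
        if "0 \<le> x" for x
      proof -
        have "\<bar>eps p * U p h x powr - (p / 2 - 1)\<bar> \<le> b / 3 * (p - 4) * S"
          unfolding abs_mult using eps(1,2)[OF p(1)] U_powr_le_S[OF p h, of "p / 2 - 1"] p b
          by (intro mult_mono) auto
        also have "\<dots> \<le> b / 3 * (p - 4) * S * exp (\<mu> * x)"
          using mult_left_mono[OF exp_mu_ge_1[OF that], of "b / 3 * (p - 4) * S"] b p S_ge_1 by simp
        finally show ?thesis .
      qed
      show "4 * A h + d \<le> \<mu>\<^sup>2" unfolding mu(2) d_def using A_bounds[OF h] by linarith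
      show "0 \<le> 4 * A h" using A_bounds[OF h] A0 by linarith
    qed (use u' v' mu d x K0(2)[OF ph] in auto)
    moreover have "K0 * (p - 4) + b / 3 * (p - 4) * S / d = (K0 + b / 3 * S / d) * (p - 4)"
      unfolding distrib_right by simp
    ultimately show "\<bar>U p h x - U 4 h x\<bar> \<le> (K0 + b / 3 * S / d) * (p - 4) * exp (\<mu> * x)"
      by simp
  qed
qed

text \<open>Subtracting the two equations for the values at the origin and writing the difference of the
  powers with its secant slope \<open>V\<close> gives an equation that is linear in the difference.\<close>

lemma center_h_equation:
  assumes p: "4 \<le> p" "p \<le> 5" and h: "\<bar>h\<bar> \<le> \<tau>"
    and V: "U p h 0 powr - (p / 2 - 2) - U p 0 0 powr - (p / 2 - 2) = - V * (U p h 0 - U p 0 0)"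
  shows "(4 * A 0 * (U p h 0 + U p 0 0) + C 0 + kap p * V) * (U p h 0 - U p 0 0)
           = - 4 * (A h - A 0) * (U p h 0)\<^sup>2 - \<beta> * h * U p h 0"
proof -
  have 0: "\<bar>0\<bar> \<le> \<tau>" using tau by simp
  define m where "m = U p h 0"
  define n where "n = U p 0 0"
  have "4 * A h * m\<^sup>2 + C h * m - (4 * A 0 * n\<^sup>2 + C 0 * n) = kap p * (- V * (m - n))"
    using U_center[OF p(1) h] U_center[OF p(1) 0] V
    by (simp add: m_def n_def right_diff_distrib[symmetric])
  moreover have "C h = C 0 + \<beta> * h" by (rule C_eq)
  ultimately have "(4 * A 0 * (m + n) + C 0 + kap p * V) * (m - n)
      = - 4 * (A h - A 0) * m\<^sup>2 - \<beta> * h * m"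
    by (simp add: algebra_simps power2_eq_square)
  then show ?thesis by (simp add: m_def n_def)
qed

lemma center_h_coercive:
  assumes p: "4 \<le> p" "p \<le> 5" and h: "\<bar>h\<bar> \<le> \<tau>" and V: "0 \<le> V"
  shows "1 / (4 * hi) \<le> 4 * A 0 * (U p h 0 + U p 0 0) + C 0 + kap p * V"
proof -
  have 0: "\<bar>0\<bar> \<le> \<tau>" using tau by simp
  have "0 \<le> 4 * A 0 * U p h 0" using A0 U_pos[OF p(1) h, of 0] by simp
  moreover have "0 \<le> kap p * V" using kap(1)[OF p(1)] V by simp
  ultimately show ?thesis using center_coercive[OF p 0] unfolding distrib_left by linarith
qed

lemma center_h_diff:
  "\<exists>K\<ge>0. \<forall>p\<in>{4..5}. \<forall>h\<in>{-\<tau>..\<tau>}. \<bar>U p h 0 - U p 0 0\<bar> \<le> K * \<bar>h\<bar>"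
proof (intro exI conjI ballI)
  define B where "B = 4 * amax * hi\<^sup>2 + \<bar>\<beta>\<bar> * hi"
  show "0 \<le> 4 * hi * B" using amax_nonneg hi by (simp add: B_def)
  fix p h :: real assume "p \<in> {4..5}" "h \<in> {-\<tau>..\<tau>}"
  then have p: "4 \<le> p" "p \<le> 5" and h: "\<bar>h\<bar> \<le> \<tau>" by auto
  obtain V where V: "0 \<le> V"
    "U p h 0 powr - (p / 2 - 2) - U p 0 0 powr - (p / 2 - 2) = - V * (U p h 0 - U p 0 0)"
    using center_slope[OF p h] by blast
  define m where "m = U p h 0"
  have m: "0 < m" "m \<le> hi" using U_pos[OF p(1) h] center_bounds[OF p h] by (auto simp: m_def)
  have "\<bar>4 * (A h - A 0) * m\<^sup>2\<bar> \<le> 4 * (amax * \<bar>h\<bar>) * hi\<^sup>2"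
    unfolding abs_mult using A_diff[OF h] m amax_nonneg by (intro mult_mono power_mono) auto
  moreover have "\<bar>\<beta> * h * m\<bar> \<le> \<bar>\<beta>\<bar> * \<bar>h\<bar> * hi"
    unfolding abs_mult using m by (intro mult_left_mono) auto
  moreover have "4 * (amax * \<bar>h\<bar>) * hi\<^sup>2 + \<bar>\<beta>\<bar> * \<bar>h\<bar> * hi = B * \<bar>h\<bar>"
    by (simp add: B_def algebra_simps)
  ultimately have "\<bar>- 4 * (A h - A 0) * m\<^sup>2 - \<beta> * h * m\<bar> \<le> B * \<bar>h\<bar>" by linarith
  then have "\<bar>U p h 0 - U p 0 0\<bar> \<le> 4 * hi * (B * \<bar>h\<bar>)"
    using center_h_equation[OF p h V(2)] by (intro coercive_bound[OF center_h_coercive[OF p h V(1)]]) (simp add: m_def)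
  then show "\<bar>U p h 0 - U p 0 0\<bar> \<le> 4 * hi * B * \<bar>h\<bar>" by (simp add: mult_ac)
qed

text \<open>The secant slope turns the nonlinear equation for the difference into a linear one, without
  remainder.\<close>

lemma U_h_equation:
  assumes p: "4 \<le> p" "p \<le> 4 + \<delta>" and h: "\<bar>h\<bar> \<le> \<tau>"
  obtains z' V where "\<And>x. ((\<lambda>x. U p h x - U p 0 x) has_real_derivative z' x) (at x)" "z' 0 = 0"
    "\<And>x. 0 \<le> V x" "\<And>x. V x \<le> 3 / 2 * S"
    "\<And>x. (z' has_real_derivative (4 * A 0 - eps p * V x) * (U p h x - U p 0 x)
             + (4 * (A h - A 0) * U p h x + \<beta> * h / 2)) (at x)"
proof -
  have 0: "\<bar>0\<bar> \<le> \<tau>" using tau by simp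
  obtain u' where u': "\<And>x. (U p h has_real_derivative u' x) (at x)" "u' 0 = 0"
    "\<And>x. (u' has_real_derivative
           4 * A h * U p h x + C h / 2 + eps p * U p h x powr - (p / 2 - 1)) (at x)"
    using U_derivs[OF p(1) h] by blast
  obtain v' where v': "\<And>x. (U p 0 has_real_derivative v' x) (at x)" "v' 0 = 0"
    "\<And>x. (v' has_real_derivative
           4 * A 0 * U p 0 x + C 0 / 2 + eps p * U p 0 x powr - (p / 2 - 1)) (at x)"
    using U_derivs[OF p(1) 0] by blast
  obtain V where V: "\<And>x. 0 \<le> V x" "\<And>x. V x \<le> 3 / 2 * S"
    "\<And>x. U p h x powr - (p / 2 - 1) - U p 0 x powr - (p / 2 - 1) = - V x * (U p h x - U p 0 x)"
    using U_slope[OF p(1) delta_p[OF p(2)] h] by metis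
  show ?thesis
  proof (rule that[of "\<lambda>x. u' x - v' x" V])
    show "((\<lambda>x. U p h x - U p 0 x) has_real_derivative u' x - v' x) (at x)" for x
      by (intro DERIV_diff u' v')
    fix x
    have V': "U p h x powr - (p / 2 - 1) = U p 0 x powr - (p / 2 - 1) - V x * (U p h x - U p 0 x)"
      using V(3)[of x] by simp
    show "((\<lambda>x. u' x - v' x) has_real_derivative (4 * A 0 - eps p * V x) * (U p h x - U p 0 x)
             + (4 * (A h - A 0) * U p h x + \<beta> * h / 2)) (at x)"
      by (rule DERIV_cong[OF DERIV_diff[OF u'(3) v'(3)]])
        (unfold V', simp add: C_eq[of h] algebra_simps add_divide_distrib)
  qed (use V u' v' in auto)
qed

lemma Q_bounds:
  assumes p: "4 \<le> p" "p \<le> 4 + \<delta>" and V: "0 \<le> V" "V \<le> 3 / 2 * S"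
  shows "0 \<le> 4 * A 0 - eps p * V" "4 * A 0 - eps p * V + 9 / 16 * A 0 \<le> \<mu>\<^sup>2"
proof -
  have "eps p * V \<le> eps p * (3 / 2 * S)" using eps(1)[OF p(1)] V by (intro mult_left_mono) auto
  then show "0 \<le> 4 * A 0 - eps p * V" using eps_small[OF p] A0 by linarith
  have "0 \<le> eps p * V" using eps(1)[OF p(1)] V by simp
  then show "4 * A 0 - eps p * V + 9 / 16 * A 0 \<le> \<mu>\<^sup>2" unfolding mu(2) using A0 by linarith
qed

lemma U_h_diff:
  "\<exists>K\<ge>0. \<forall>p\<in>{4..4+\<delta>}. \<forall>h\<in>{-\<tau>..\<tau>}. \<forall>x\<ge>0.
     \<bar>U p h x - U p 0 x\<bar> \<le> K * \<bar>h\<bar> * exp (\<mu> * x)"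
proof -
  obtain K0 where K0: "0 \<le> K0"
    "\<And>p h. p \<in> {4..5} \<Longrightarrow> h \<in> {-\<tau>..\<tau>} \<Longrightarrow> \<bar>U p h 0 - U p 0 0\<bar> \<le> K0 * \<bar>h\<bar>"
    using center_h_diff by blast
  obtain Ku where Ku: "0 \<le> Ku"
    "\<And>p h x. p \<in> {4..5} \<Longrightarrow> h \<in> {-\<tau>..\<tau>} \<Longrightarrow> 0 \<le> x \<Longrightarrow> U p h x \<le> Ku * exp (\<mu> * x)"
    using U_exp_upper by blast
  show ?thesis
  proof (intro exI conjI ballI allI impI)
    define d where "d = 9 / 16 * A 0"
    have d: "0 < d" using A0 by (simp add: d_def)
    define R where "R = 4 * amax * Ku + \<bar>\<beta>\<bar> / 2"
    show "0 \<le> K0 + R / d" using K0 Ku amax_nonneg d by (simp add: R_def)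
    fix p h x :: real assume ph: "p \<in> {4..4+\<delta>}" "h \<in> {-\<tau>..\<tau>}" and x: "(0::real) \<le> x"
    then have p: "4 \<le> p" "p \<le> 4 + \<delta>" and h: "\<bar>h\<bar> \<le> \<tau>" and p5: "p \<in> {4..5}"
      using delta by auto
    obtain z' V where z': "\<And>x. ((\<lambda>x. U p h x - U p 0 x) has_real_derivative z' x) (at x)" "z' 0 = 0"
      and V: "\<And>x. 0 \<le> V x" "\<And>x. V x \<le> 3 / 2 * S"
      and z'': "\<And>x. (z' has_real_derivative (4 * A 0 - eps p * V x) * (U p h x - U p 0 x)
             + (4 * (A h - A 0) * U p h x + \<beta> * h / 2)) (at x)"
      using U_h_equation[OF p h] by blast
    have "\<bar>U p h x - U p 0 x\<bar> \<le> (K0 * \<bar>h\<bar> + R * \<bar>h\<bar> / d) * exp (\<mu> * x)"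
    proof (rule growth_bound[where z = "\<lambda>x. U p h x - U p 0 x" and z' = z'
          and Q = "\<lambda>x. 4 * A 0 - eps p * V x" and r = "\<lambda>x. 4 * (A h - A 0) * U p h x + \<beta> * h / 2"])
      show "\<bar>4 * (A h - A 0) * U p h x + \<beta> * h / 2\<bar> \<le> R * \<bar>h\<bar> * exp (\<mu> * x)"
        if "0 \<le> x" for x
      proof -
        have "\<bar>4 * (A h - A 0) * U p h x\<bar> \<le> 4 * (amax * \<bar>h\<bar>) * (Ku * exp (\<mu> * x))"
          unfolding abs_mult using A_diff[OF h] Ku(2)[OF p5 ph(2) that] U_pos[OF p(1) h, of x] amax_nonneg
          by (intro mult_mono) auto
        moreover have "\<bar>\<beta> * h / 2\<bar> * 1 \<le> \<bar>\<beta> * h / 2\<bar> * exp (\<mu> * x)"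
          using exp_mu_ge_1[OF that] by (intro mult_left_mono) auto
        moreover have "R * \<bar>h\<bar> * exp (\<mu> * x)
            = 4 * (amax * \<bar>h\<bar>) * (Ku * exp (\<mu> * x)) + \<bar>\<beta> * h / 2\<bar> * exp (\<mu> * x)"
          by (simp add: R_def abs_mult algebra_simps)
        ultimately show ?thesis by linarith
      qed
      show "\<bar>U p h 0 - U p 0 0\<bar> \<le> K0 * \<bar>h\<bar>" by (rule K0(2)[OF p5 ph(2)])
      show "4 * A 0 - eps p * V x + d \<le> \<mu>\<^sup>2" "0 \<le> 4 * A 0 - eps p * V x" for x
        unfolding d_def by (rule Q_bounds[OF p V])+
    qed (use z' z'' mu d x in auto)
    then show "\<bar>U p h x - U p 0 x\<bar> \<le> (K0 + R / d) * \<bar>h\<bar> * exp (\<mu> * x)"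
      by (simp add: algebra_simps)
  qed
qed

text \<open>The equations of \<open>center_h_equation\<close> for \<open>p\<close> and for \<open>4\<close> have coefficients that differ by
  \<open>O(p - 4)\<close>, and their right-hand sides differ by \<open>O(\<bar>h\<bar> (p - 4))\<close>.\<close>

lemma center_mixed_diff:
  "\<exists>K\<ge>0. \<forall>p\<in>{4..5}. \<forall>h\<in>{-\<tau>..\<tau>}.
     \<bar>(U p h 0 - U p 0 0) - (U 4 h 0 - U 4 0 0)\<bar> \<le> K * \<bar>h\<bar> * (p - 4)"
proof -
  obtain K1 where K1: "0 \<le> K1"
    "\<And>p h. p \<in> {4..5} \<Longrightarrow> h \<in> {-\<tau>..\<tau>} \<Longrightarrow> \<bar>U p h 0 - U p 0 0\<bar> \<le> K1 * \<bar>h\<bar>"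
    using center_h_diff by blast
  obtain K2 where K2: "0 \<le> K2"
    "\<And>p h. p \<in> {4..5} \<Longrightarrow> h \<in> {-\<tau>..\<tau>} \<Longrightarrow> \<bar>U p h 0 - U 4 h 0\<bar> \<le> K2 * (p - 4)"
    using center_p_diff by blast
  have 0: "\<bar>0\<bar> \<le> \<tau>" "0 \<in> {-\<tau>..\<tau>}" using tau by auto
  show ?thesis
  proof (intro exI conjI ballI)
    define B where "B = 4 * amax * (2 * hi * K2) + \<bar>\<beta>\<bar> * K2
        + (4 * A 0 * (2 * K2) + 2 * b * (S / 2)) * K1"
    have B: "0 \<le> B" unfolding B_def using K1 K2 hi A0 b S_ge_1 amax_nonneg
      by (intro add_nonneg_nonneg mult_nonneg_nonneg) auto
    show "0 \<le> 4 * hi * B" using B hi by simp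
    fix p h :: real assume pT: "p \<in> {4..5}" and hT: "h \<in> {-\<tau>..\<tau>}"
    then have p: "4 \<le> p" "p \<le> 5" and h: "\<bar>h\<bar> \<le> \<tau>" by auto
    have p4: "(4::real) \<le> 4" "(4::real) \<le> 5" by auto
    obtain V where V: "0 \<le> V" "V \<le> (p - 4) / 2 * S"
      "U p h 0 powr - (p / 2 - 2) - U p 0 0 powr - (p / 2 - 2) = - V * (U p h 0 - U p 0 0)"
      using center_slope[OF p h] by blast
    define m where "m = U p h 0"
    define m0 where "m0 = U p 0 0"
    define n where "n = U 4 h 0"
    define n0 where "n0 = U 4 0 0"
    have m: "0 < m" "m \<le> hi" using U_pos[OF p(1) h] center_bounds[OF p h] by (auto simp: m_def)
    have n: "0 < n" "n \<le> hi" using U_pos[OF p4(1) h] center_bounds[OF p4 h] by (auto simp: n_def)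
    have n0: "0 < n0" using U_pos[OF p4(1) 0(1)] by (auto simp: n0_def)
    have eqm: "(4 * A 0 * (m + m0) + C 0 + kap p * V) * (m - m0) = - 4 * (A h - A 0) * m\<^sup>2 - \<beta> * h * m"
      using center_h_equation[OF p h V(3)] by (simp add: m_def m0_def)
    have eqn: "(4 * A 0 * (n + n0) + C 0) * (n - n0) = - 4 * (A h - A 0) * n\<^sup>2 - \<beta> * h * n"
      using center_h_equation[OF p4 h, of 0] n n0 by (simp add: n_def n0_def)
    have co: "1 / (4 * hi) \<le> 4 * A 0 * (n + n0) + C 0"
      using center_h_coercive[OF p4 h, of 0] by (simp add: n_def n0_def)
    have mn: "\<bar>m - n\<bar> \<le> K2 * (p - 4)" and mn0: "\<bar>m0 - n0\<bar> \<le> K2 * (p - 4)" and mm: "\<bar>m - m0\<bar> \<le> K1 * \<bar>h\<bar>"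
      unfolding m_def n_def m0_def n0_def by (intro K1 K2 pT hT 0)+
    have "(4 * A 0 * (n + n0) + C 0) * ((m - m0) - (n - n0))
        = (4 * A 0 * (m + m0) + C 0 + kap p * V) * (m - m0) - (4 * A 0 * (n + n0) + C 0) * (n - n0)
          - (4 * A 0 * ((m - n) + (m0 - n0)) + kap p * V) * (m - m0)"
      by (simp add: algebra_simps)
    also have "\<dots> = - 4 * (A h - A 0) * ((m + n) * (m - n)) - \<beta> * h * (m - n)
          - (4 * A 0 * ((m - n) + (m0 - n0)) + kap p * V) * (m - m0)"
      unfolding eqm eqn by (simp add: algebra_simps power2_eq_square)
    finally have eq: "(4 * A 0 * (n + n0) + C 0) * ((m - m0) - (n - n0))
        = - 4 * (A h - A 0) * ((m + n) * (m - n)) - \<beta> * h * (m - n)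
          - (4 * A 0 * ((m - n) + (m0 - n0)) + kap p * V) * (m - m0)" .
    have "\<bar>4 * (A h - A 0) * ((m + n) * (m - n))\<bar> \<le> 4 * (amax * \<bar>h\<bar>) * ((2 * hi) * (K2 * (p - 4)))"
      unfolding abs_mult using A_diff[OF h] m n mn hi K2 p amax_nonneg
      by (intro mult_mono mult_nonneg_nonneg) auto
    moreover have "\<bar>\<beta> * h * (m - n)\<bar> \<le> \<bar>\<beta>\<bar> * \<bar>h\<bar> * (K2 * (p - 4))"
      unfolding abs_mult using mn by (intro mult_left_mono) auto
    moreover have "\<bar>(4 * A 0 * ((m - n) + (m0 - n0)) + kap p * V) * (m - m0)\<bar>
        \<le> ((4 * A 0 * (2 * K2) + 2 * b * (S / 2)) * (p - 4)) * (K1 * \<bar>h\<bar>)"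
    proof -
      have "\<bar>4 * A 0 * ((m - n) + (m0 - n0))\<bar> \<le> 4 * A 0 * (2 * (K2 * (p - 4)))"
        unfolding abs_mult using mn mn0 A0 by (intro mult_mono) auto
      moreover have "\<bar>kap p * V\<bar> \<le> 2 * b * ((p - 4) / 2 * S)"
        unfolding abs_mult using kap(1,2)[OF p(1)] V b by (intro mult_mono) auto
      moreover have "4 * A 0 * (2 * (K2 * (p - 4))) + 2 * b * ((p - 4) / 2 * S)
          = (4 * A 0 * (2 * K2) + 2 * b * (S / 2)) * (p - 4)"
        by (simp add: field_simps)
      ultimately have "\<bar>4 * A 0 * ((m - n) + (m0 - n0)) + kap p * V\<bar>
          \<le> (4 * A 0 * (2 * K2) + 2 * b * (S / 2)) * (p - 4)" by linarith
      then show ?thesis unfolding abs_mult[of _ "m - m0"]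
        by (rule mult_mono[OF _ mm]) (use A0 K2 b S_ge_1 p in auto)
    qed
    moreover have "B * \<bar>h\<bar> * (p - 4) = 4 * (amax * \<bar>h\<bar>) * ((2 * hi) * (K2 * (p - 4)))
        + \<bar>\<beta>\<bar> * \<bar>h\<bar> * (K2 * (p - 4)) + ((4 * A 0 * (2 * K2) + 2 * b * (S / 2)) * (p - 4)) * (K1 * \<bar>h\<bar>)"
      by (simp add: B_def algebra_simps)
    ultimately have "\<bar>(4 * A 0 * (n + n0) + C 0) * ((m - m0) - (n - n0))\<bar> \<le> B * \<bar>h\<bar> * (p - 4)"
      unfolding eq by linarith
    then have "\<bar>(m - m0) - (n - n0)\<bar> \<le> 4 * hi * (B * \<bar>h\<bar> * (p - 4))" by (rule coercive_bound[OF co])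
    then show "\<bar>(U p h 0 - U p 0 0) - (U 4 h 0 - U 4 0 0)\<bar> \<le> 4 * hi * B * \<bar>h\<bar> * (p - 4)"
      by (simp add: m_def m0_def n_def n0_def mult_ac)
  qed
qed

text \<open>The mixed second difference is a difference quotient for \<open>p\<close> minus the one for \<open>4\<close>, multiplied
  by \<open>h\<close>.  At \<open>p = 4\<close> the equation is linear, so the nonlinear term contributes only for \<open>p\<close>, with the
  small coefficient \<open>eps p\<close>.\<close>

lemma U_mixed_diff:
  "\<exists>K\<ge>0. \<forall>p\<in>{4..4+\<delta>}. \<forall>h\<in>{-\<tau>..\<tau>}. \<forall>x\<ge>0.
     \<bar>(U p h x - U p 0 x) - (U 4 h x - U 4 0 x)\<bar> \<le> K * \<bar>h\<bar> * (p - 4) * exp (\<mu> * x)"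
proof -
  obtain K0 where K0: "0 \<le> K0" "\<And>p h. p \<in> {4..5} \<Longrightarrow> h \<in> {-\<tau>..\<tau>} \<Longrightarrow>
      \<bar>(U p h 0 - U p 0 0) - (U 4 h 0 - U 4 0 0)\<bar> \<le> K0 * \<bar>h\<bar> * (p - 4)"
    using center_mixed_diff by blast
  obtain K1 where K1: "0 \<le> K1"
    "\<And>p h x. p \<in> {4..4+\<delta>} \<Longrightarrow> h \<in> {-\<tau>..\<tau>} \<Longrightarrow> 0 \<le> x \<Longrightarrow>
       \<bar>U p h x - U p 0 x\<bar> \<le> K1 * \<bar>h\<bar> * exp (\<mu> * x)"
    using U_h_diff by blast
  obtain K2 where K2: "0 \<le> K2"
    "\<And>p h x. p \<in> {4..5} \<Longrightarrow> h \<in> {-\<tau>..\<tau>} \<Longrightarrow> 0 \<le> x \<Longrightarrow>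
       \<bar>U p h x - U 4 h x\<bar> \<le> K2 * (p - 4) * exp (\<mu> * x)"
    using U_p_diff by blast
  define d where "d = 9 / 16 * A 0"
  have d: "0 < d" using A0 by (simp add: d_def)
  define R where "R = 4 * amax * K2 + b / 3 * (3 / 2 * S) * K1"
  have R: "0 \<le> R" using K1 K2 b S_ge_1 amax_nonneg by (simp add: R_def)
  have main: "\<bar>(U p h x - U p 0 x) - (U 4 h x - U 4 0 x)\<bar>
      \<le> (K0 + R / d) * \<bar>h\<bar> * (p - 4) * exp (\<mu> * x)"
    if pT: "p \<in> {4..4+\<delta>}" and hT: "h \<in> {-\<tau>..\<tau>}" and x: "0 \<le> x" for p h x
  proof -
    have p: "4 \<le> p" "p \<le> 4 + \<delta>" and h: "\<bar>h\<bar> \<le> \<tau>" and p5: "p \<in> {4..5}"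
      and p4: "(4::real) \<le> 4" "(4::real) \<le> 4 + \<delta>"
      using delta pT hT by auto
    obtain y' V where y': "\<And>x. ((\<lambda>x. U p h x - U p 0 x) has_real_derivative y' x) (at x)" "y' 0 = 0"
      and V: "\<And>x. 0 \<le> V x" "\<And>x. V x \<le> 3 / 2 * S"
      and y'': "\<And>x. (y' has_real_derivative (4 * A 0 - eps p * V x) * (U p h x - U p 0 x)
             + (4 * (A h - A 0) * U p h x + \<beta> * h / 2)) (at x)"
      using U_h_equation[OF p h] by blast
    obtain z' W where z': "\<And>x. ((\<lambda>x. U 4 h x - U 4 0 x) has_real_derivative z' x) (at x)" "z' 0 = 0"
      and "\<And>x. 0 \<le> W x" "\<And>x. W x \<le> 3 / 2 * S"
      and z'': "\<And>x. (z' has_real_derivative (4 * A 0 - eps 4 * W x) * (U 4 h x - U 4 0 x)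
             + (4 * (A h - A 0) * U 4 h x + \<beta> * h / 2)) (at x)"
      using U_h_equation[OF p4 h] by blast
    have "\<bar>(U p h x - U p 0 x) - (U 4 h x - U 4 0 x)\<bar>
        \<le> (K0 * \<bar>h\<bar> * (p - 4) + R * \<bar>h\<bar> * (p - 4) / d) * exp (\<mu> * x)"
    proof (rule growth_bound[where z = "\<lambda>x. (U p h x - U p 0 x) - (U 4 h x - U 4 0 x)"
          and z' = "\<lambda>x. y' x - z' x" and Q = "\<lambda>x. 4 * A 0"
          and r = "\<lambda>x. 4 * (A h - A 0) * (U p h x - U 4 h x) - eps p * V x * (U p h x - U p 0 x)"])
      show "((\<lambda>x. (U p h x - U p 0 x) - (U 4 h x - U 4 0 x)) has_real_derivative y' x - z' x) (at x)" for x
        by (intro DERIV_diff y' z')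
      show "((\<lambda>x. y' x - z' x) has_real_derivative
          4 * A 0 * ((U p h x - U p 0 x) - (U 4 h x - U 4 0 x))
          + (4 * (A h - A 0) * (U p h x - U 4 h x) - eps p * V x * (U p h x - U p 0 x))) (at x)" for x
        by (rule DERIV_cong[OF DERIV_diff[OF y'' z'']]) (simp add: eps(3) algebra_simps)
      show "\<bar>4 * (A h - A 0) * (U p h x - U 4 h x) - eps p * V x * (U p h x - U p 0 x)\<bar>
          \<le> R * \<bar>h\<bar> * (p - 4) * exp (\<mu> * x)" if x: "0 \<le> x" for x
      proof -
        have "\<bar>4 * (A h - A 0) * (U p h x - U 4 h x)\<bar>
            \<le> 4 * (amax * \<bar>h\<bar>) * (K2 * (p - 4) * exp (\<mu> * x))"
          unfolding abs_mult using A_diff[OF h] K2(2)[OF p5 hT x] amax_nonneg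
          by (intro mult_mono) auto
        moreover have "\<bar>eps p * V x * (U p h x - U p 0 x)\<bar>
            \<le> (b / 3 * (p - 4)) * (3 / 2 * S) * (K1 * \<bar>h\<bar> * exp (\<mu> * x))"
          unfolding abs_mult using eps(1,2)[OF p(1)] V[of x] K1(2)[OF pT hT x] b p S_ge_1
          by (intro mult_mono) auto
        moreover have "R * \<bar>h\<bar> * (p - 4) * exp (\<mu> * x) = 4 * (amax * \<bar>h\<bar>) * (K2 * (p - 4) * exp (\<mu> * x))
            + (b / 3 * (p - 4)) * (3 / 2 * S) * (K1 * \<bar>h\<bar> * exp (\<mu> * x))"
          unfolding R_def distrib_right by (simp only: mult_ac)
        ultimately show ?thesis by linarith
      qed
      show "4 * A 0 + d \<le> \<mu>\<^sup>2" unfolding mu(2) d_def using A0 by linarith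
    qed (use y' z' mu d x A0 K0(2)[OF p5 hT] in auto)
    moreover have "K0 * \<bar>h\<bar> * (p - 4) + R * \<bar>h\<bar> * (p - 4) / d = (K0 + R / d) * \<bar>h\<bar> * (p - 4)"
      unfolding distrib_right by simp
    ultimately show ?thesis by simp
  qed
  show ?thesis
    by (intro exI[of _ "K0 + R / d"] conjI ballI allI impI main) (use K0 R d in auto)
qed

section \<open>Differentiability in the curve parameter\<close>

text \<open>Stated for abstract summands because linear arithmetic multiplies out the products for which it
  is used.\<close>

lemma abs_sum5_le:
  fixes x :: real
  assumes "x = - t1 - t2 - t3 - t4 + t5"
    and "\<bar>t1\<bar> \<le> b1" "\<bar>t2\<bar> \<le> b2" "\<bar>t3\<bar> \<le> b3" "\<bar>t4\<bar> \<le> b4" "\<bar>t5\<bar> \<le> b5"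
  shows "\<bar>x\<bar> \<le> b1 + b2 + b3 + b4 + b5"
  using assms by linarith

text \<open>Expanding to second order gives \<open>N (m - n) = h (N d) + O(h\<^sup>2)\<close>, where \<open>N\<close> is the derivative of
  the equation in its unknown; \<open>d\<close> is the derivative that the implicit function theorem predicts.\<close>

lemma center_second_order:
  "\<exists>K\<ge>0. \<forall>p\<in>{4..5}. \<exists>d. \<forall>h\<in>{-\<tau>..\<tau>}. \<bar>U p h 0 - U p 0 0 - d * h\<bar> \<le> K * h\<^sup>2"
proof -
  obtain K0 where K0: "0 \<le> K0"
    "\<And>p h. p \<in> {4..5} \<Longrightarrow> h \<in> {-\<tau>..\<tau>} \<Longrightarrow> \<bar>U p h 0 - U p 0 0\<bar> \<le> K0 * \<bar>h\<bar>"
    using center_h_diff by blast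
  have 0: "\<bar>0\<bar> \<le> \<tau>" using tau by simp
  define B where "B = 4 * \<bar>\<alpha>\<^sub>1\<bar> * (2 * hi * K0) + 4 * \<bar>\<alpha>\<^sub>2\<bar> * hi\<^sup>2 + \<bar>\<beta>\<bar> * K0
      + 4 * A 0 * K0\<^sup>2 + 2 * b * (S * K0\<^sup>2)"
  have B: "0 \<le> B" unfolding B_def using K0 hi A0 b S_ge_1
    by (intro add_nonneg_nonneg mult_nonneg_nonneg) auto
  show ?thesis
  proof (rule exI[of _ "4 * hi * B"], intro conjI ballI)
    show "0 \<le> 4 * hi * B" using B hi by simp
    fix p :: real assume p5: "p \<in> {4..5}"
    then have p: "4 \<le> p" "p \<le> 5" by auto
    define n where "n = U p 0 0"
    have n: "0 < n" "n \<le> hi" using U_pos[OF p(1) 0] center_bounds[OF p 0] by (auto simp: n_def)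
    define D where "D = (p / 2 - 2) * n powr - (p / 2 - 1)"
    have D: "0 \<le> D" using p by (simp add: D_def)
    define N where "N = 8 * A 0 * n + C 0 + kap p * D"
    have N: "1 / (4 * hi) \<le> N"
      using center_h_coercive[OF p 0 D] by (simp add: N_def n_def)
    then have N0: "0 < N" using hi by (smt (verit) divide_pos_pos)
    show "\<exists>d. \<forall>h\<in>{-\<tau>..\<tau>}. \<bar>U p h 0 - U p 0 0 - d * h\<bar> \<le> 4 * hi * B * h\<^sup>2"
    proof (intro exI ballI)
      fix h assume hT: "h \<in> {-\<tau>..\<tau>}"
      then have h: "\<bar>h\<bar> \<le> \<tau>" by auto
      define m where "m = U p h 0"
      have m: "0 < m" "m \<le> hi" using U_pos[OF p(1) h] center_bounds[OF p h] by (auto simp: m_def)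
      have mn: "\<bar>m - n\<bar> \<le> K0 * \<bar>h\<bar>" using K0(2)[OF p5 hT] by (simp add: m_def n_def)
      define Rem where "Rem = m powr - (p / 2 - 2) - n powr - (p / 2 - 2) + D * (m - n)"
      have hh: "h\<^sup>2 = \<bar>h\<bar> * \<bar>h\<bar>" by (simp add: power2_eq_square)
      have mn2: "(m - n)\<^sup>2 \<le> K0\<^sup>2 * h\<^sup>2"
        using power_mono[OF mn, of 2] by (simp add: power_mult_distrib)
      have Rem: "\<bar>Rem\<bar> \<le> S * (K0\<^sup>2 * h\<^sup>2)"
      proof -
        have "\<bar>Rem\<bar> \<le> S * (m - n)\<^sup>2"
          using center_taylor[OF p h] by (simp add: Rem_def D_def m_def n_def)
        also have "\<dots> \<le> S * (K0\<^sup>2 * h\<^sup>2)" using mn2 S_ge_1 by (intro mult_left_mono) auto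
        finally show ?thesis .
      qed
      define d where "d = (- 4 * \<alpha>\<^sub>1 * n\<^sup>2 - \<beta> * n) / N"
      have Nd: "N * d = - 4 * \<alpha>\<^sub>1 * n\<^sup>2 - \<beta> * n" using N0 by (simp add: d_def)
      have em: "4 * A h * m\<^sup>2 + C h * m = 1 / 4 + kap p * (n powr - (p / 2 - 2) - D * (m - n) + Rem)"
        using U_center[OF p(1) h] by (simp add: m_def Rem_def)
      have en: "4 * A 0 * n\<^sup>2 + C 0 * n = 1 / 4 + kap p * n powr - (p / 2 - 2)"
        using U_center[OF p(1) 0] by (simp add: n_def)
      have "N * (m - n) = - 4 * (A h - A 0) * m\<^sup>2 - (C h - C 0) * m - 4 * A 0 * (m - n)\<^sup>2 + kap p * Rem"
        using em en unfolding N_def by (simp add: algebra_simps power2_eq_square)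
      then have "N * (m - n - d * h)
          = - (4 * \<alpha>\<^sub>1 * (m\<^sup>2 - n\<^sup>2) * h) - 4 * \<alpha>\<^sub>2 * m\<^sup>2 * h\<^sup>2 - \<beta> * (m - n) * h
            - 4 * A 0 * (m - n)\<^sup>2 + kap p * Rem"
      proof -
        have "N * (m - n - d * h) = N * (m - n) - (N * d) * h" by (simp add: algebra_simps)
        moreover have "A h - A 0 = \<alpha>\<^sub>1 * h + \<alpha>\<^sub>2 * h\<^sup>2" using A_eq[of h] by simp
        ultimately show ?thesis
          using \<open>N * (m - n) = _\<close> unfolding Nd C_diff by (simp add: algebra_simps)
      qed
      moreover have "\<bar>4 * \<alpha>\<^sub>1 * (m\<^sup>2 - n\<^sup>2) * h\<bar> \<le> 4 * \<bar>\<alpha>\<^sub>1\<bar> * (2 * hi * K0) * h\<^sup>2"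
      proof -
        have "\<bar>m\<^sup>2 - n\<^sup>2\<bar> = (m + n) * \<bar>m - n\<bar>"
          using m n by (simp add: power2_eq_square square_diff_square_factored abs_mult)
        also have "\<dots> \<le> (2 * hi) * (K0 * \<bar>h\<bar>)" using m n mn hi by (intro mult_mono) auto
        finally have "\<bar>4 * \<alpha>\<^sub>1\<bar> * \<bar>m\<^sup>2 - n\<^sup>2\<bar> * \<bar>h\<bar> \<le> \<bar>4 * \<alpha>\<^sub>1\<bar> * ((2 * hi) * (K0 * \<bar>h\<bar>)) * \<bar>h\<bar>"
          by (intro mult_right_mono mult_left_mono) auto
        then show ?thesis by (simp only: hh abs_mult abs_numeral mult_ac)
      qed
      moreover have "\<bar>4 * \<alpha>\<^sub>2 * m\<^sup>2 * h\<^sup>2\<bar> \<le> 4 * \<bar>\<alpha>\<^sub>2\<bar> * hi\<^sup>2 * h\<^sup>2"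
        unfolding abs_mult using m by (intro mult_mono power_mono) auto
      moreover have "\<bar>\<beta> * (m - n) * h\<bar> \<le> \<bar>\<beta>\<bar> * K0 * h\<^sup>2"
      proof -
        have "\<bar>\<beta>\<bar> * \<bar>m - n\<bar> * \<bar>h\<bar> \<le> \<bar>\<beta>\<bar> * (K0 * \<bar>h\<bar>) * \<bar>h\<bar>"
          using mn by (intro mult_right_mono mult_left_mono) auto
        then show ?thesis by (simp only: hh abs_mult mult_ac)
      qed
      moreover have "\<bar>4 * A 0 * (m - n)\<^sup>2\<bar> \<le> 4 * A 0 * K0\<^sup>2 * h\<^sup>2"
        using mult_left_mono[OF mn2, of "4 * A 0"] A0 by (simp add: abs_mult mult_ac)
      moreover have "\<bar>kap p * Rem\<bar> \<le> 2 * b * (S * K0\<^sup>2) * h\<^sup>2"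
      proof -
        have "\<bar>kap p\<bar> * \<bar>Rem\<bar> \<le> 2 * b * (S * (K0\<^sup>2 * h\<^sup>2))"
          using kap(1,2)[OF p(1)] Rem b by (intro mult_mono) auto
        then show ?thesis by (simp add: abs_mult mult_ac)
      qed
      moreover have B_eq: "B * h\<^sup>2 = 4 * \<bar>\<alpha>\<^sub>1\<bar> * (2 * hi * K0) * h\<^sup>2 + 4 * \<bar>\<alpha>\<^sub>2\<bar> * hi\<^sup>2 * h\<^sup>2 + \<bar>\<beta>\<bar> * K0 * h\<^sup>2
          + 4 * A 0 * K0\<^sup>2 * h\<^sup>2 + 2 * b * (S * K0\<^sup>2) * h\<^sup>2"
        by (simp add: B_def distrib_right)
      ultimately have "\<bar>N * (m - n - d * h)\<bar> \<le> B * h\<^sup>2" unfolding B_eq by (intro abs_sum5_le)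
      then have "\<bar>m - n - d * h\<bar> \<le> 4 * hi * (B * h\<^sup>2)" by (rule coercive_bound[OF N])
      then show "\<bar>U p h 0 - U p 0 0 - (- 4 * \<alpha>\<^sub>1 * n\<^sup>2 - \<beta> * n) / N * h\<bar> \<le> 4 * hi * B * h\<^sup>2"
        by (simp add: m_def n_def d_def mult_ac)
    qed
  qed
qed

text \<open>With the tangent slope in place of the secant slope, the potential does not depend on \<open>h\<close>, so
  that equations for different \<open>h\<close> can be combined linearly.  The price is a quadratic remainder
  \<open>r\<close>.\<close>

lemma U_h_taylor_equation:
  assumes p: "4 \<le> p" "p \<le> 4 + \<delta>" and h: "\<bar>h\<bar> \<le> \<tau>"
  obtains z' r where "\<And>x. ((\<lambda>x. U p h x - U p 0 x) has_real_derivative z' x) (at x)" "z' 0 = 0"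
    "\<And>x. (z' has_real_derivative
        (4 * A 0 - eps p * ((p / 2 - 1) * U p 0 x powr - (p / 2))) * (U p h x - U p 0 x)
             + (4 * (A h - A 0) * U p h x + \<beta> * h / 2 + eps p * r x)) (at x)"
    "\<And>x. \<bar>r x\<bar> \<le> 4 * S * (U p h x - U p 0 x)\<^sup>2"
proof -
  have 0: "\<bar>0\<bar> \<le> \<tau>" using tau by simp
  obtain u' where u': "\<And>x. (U p h has_real_derivative u' x) (at x)" "u' 0 = 0"
    "\<And>x. (u' has_real_derivative
           4 * A h * U p h x + C h / 2 + eps p * U p h x powr - (p / 2 - 1)) (at x)"
    using U_derivs[OF p(1) h] by blast
  obtain v' where v': "\<And>x. (U p 0 has_real_derivative v' x) (at x)" "v' 0 = 0"
    "\<And>x. (v' has_real_derivative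
           4 * A 0 * U p 0 x + C 0 / 2 + eps p * U p 0 x powr - (p / 2 - 1)) (at x)"
    using U_derivs[OF p(1) 0] by blast
  define D where "D = (\<lambda>x. (p / 2 - 1) * U p 0 x powr - (p / 2))"
  define r where "r = (\<lambda>x. U p h x powr - (p / 2 - 1) - U p 0 x powr - (p / 2 - 1)
     + D x * (U p h x - U p 0 x))"
  show ?thesis
  proof (rule that[of "\<lambda>x. u' x - v' x" r])
    show "((\<lambda>x. U p h x - U p 0 x) has_real_derivative u' x - v' x) (at x)" for x
      by (intro DERIV_diff u' v')
    show "\<bar>r x\<bar> \<le> 4 * S * (U p h x - U p 0 x)\<^sup>2" for x
      unfolding r_def D_def by (rule U_taylor[OF p(1) delta_p[OF p(2)] h])
    fix x
    have D_eq: "(p / 2 - 1) * U p 0 x powr - (p / 2) = D x" by (simp add: D_def)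
    have e: "U p h x powr - (p / 2 - 1)
        = U p 0 x powr - (p / 2 - 1) - D x * (U p h x - U p 0 x) + r x"
      by (simp add: r_def)
    show "((\<lambda>x. u' x - v' x) has_real_derivative
        (4 * A 0 - eps p * ((p / 2 - 1) * U p 0 x powr - (p / 2))) * (U p h x - U p 0 x)
             + (4 * (A h - A 0) * U p h x + \<beta> * h / 2 + eps p * r x)) (at x)"
      unfolding D_eq
      by (rule DERIV_cong[OF DERIV_diff[OF u'(3) v'(3)]])
        (unfold e, simp add: C_eq[of h] algebra_simps add_divide_distrib)
  qed (use u' v' in auto)
qed

text \<open>The combination on the left is \<open>h k\<close> times a difference of two difference quotients; using it
  avoids division.  Its equation has a right-hand side of third order in \<open>(h, k)\<close>.  Quadratic
  remainders grow with the doubled exponent \<open>2 \<mu>\<close>, which is harmless because this bound serves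
  only to prove pointwise convergence.\<close>

lemma U_second_order:
  "\<exists>K\<ge>0. \<forall>p\<in>{4..4+\<delta>}. \<forall>h\<in>{-\<tau>..\<tau>}. \<forall>k\<in>{-\<tau>..\<tau>}. \<forall>x\<ge>0.
     \<bar>k * (U p h x - U p 0 x) - h * (U p k x - U p 0 x)\<bar>
       \<le> K * (\<bar>h\<bar> * \<bar>k\<bar> * (\<bar>h\<bar> + \<bar>k\<bar>)) * exp (2 * \<mu> * x)"
proof -
  have 0: "\<bar>0\<bar> \<le> \<tau>" using tau by simp
  obtain K0 where K0: "0 \<le> K0" "\<And>p. p \<in> {4..5} \<Longrightarrow>
      \<exists>d. \<forall>h\<in>{-\<tau>..\<tau>}. \<bar>U p h 0 - U p 0 0 - d * h\<bar> \<le> K0 * h\<^sup>2"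
    using center_second_order by blast
  obtain K1 where K1: "0 \<le> K1"
    "\<And>p h x. p \<in> {4..4+\<delta>} \<Longrightarrow> h \<in> {-\<tau>..\<tau>} \<Longrightarrow> 0 \<le> x \<Longrightarrow>
       \<bar>U p h x - U p 0 x\<bar> \<le> K1 * \<bar>h\<bar> * exp (\<mu> * x)"
    using U_h_diff by blast
  obtain Ku where Ku: "0 \<le> Ku"
    "\<And>p h x. p \<in> {4..5} \<Longrightarrow> h \<in> {-\<tau>..\<tau>} \<Longrightarrow> 0 \<le> x \<Longrightarrow> U p h x \<le> Ku * exp (\<mu> * x)"
    using U_exp_upper by blast
  define d where "d = 9 / 16 * A 0"
  have d: "0 < d" using A0 by (simp add: d_def)
  define R where "R = 4 * (\<bar>\<alpha>\<^sub>1\<bar> * K1 + \<bar>\<alpha>\<^sub>2\<bar> * Ku) + b * (4 * S * K1\<^sup>2)"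
  have R: "0 \<le> R" using K1 Ku b S_ge_1 by (simp add: R_def)
  have main: "\<bar>k * (U p h x - U p 0 x) - h * (U p k x - U p 0 x)\<bar>
       \<le> (K0 + R / d) * (\<bar>h\<bar> * \<bar>k\<bar> * (\<bar>h\<bar> + \<bar>k\<bar>)) * exp (2 * \<mu> * x)"
    if pT: "p \<in> {4..4+\<delta>}" and hT: "h \<in> {-\<tau>..\<tau>}" and kT: "k \<in> {-\<tau>..\<tau>}" and x: "0 \<le> x" for p h k x
  proof -
    have p: "4 \<le> p" "p \<le> 4 + \<delta>" and h: "\<bar>h\<bar> \<le> \<tau>" and k: "\<bar>k\<bar> \<le> \<tau>" and p5: "p \<in> {4..5}"
      using delta pT hT kT by auto
    obtain c where c: "\<And>h. h \<in> {-\<tau>..\<tau>} \<Longrightarrow> \<bar>U p h 0 - U p 0 0 - c * h\<bar> \<le> K0 * h\<^sup>2"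
      using K0(2)[OF p5] by blast
    define V where "V = (\<lambda>x. (p / 2 - 1) * U p 0 x powr - (p / 2))"
    define H where "H = \<bar>h\<bar> * \<bar>k\<bar> * (\<bar>h\<bar> + \<bar>k\<bar>)"
    have H: "0 \<le> H" by (simp add: H_def)
    have V: "0 \<le> V x" "V x \<le> 3 / 2 * S" for x
    proof -
      show "0 \<le> V x" using p by (simp add: V_def)
      show "V x \<le> 3 / 2 * S" unfolding V_def
        by (rule mult_mono[OF _ U_powr_le_S[OF p(1) delta_p[OF p(2)] 0]])
          (use p delta_p[OF p(2)] in auto)
    qed
    obtain y' r where y': "\<And>x. ((\<lambda>x. U p h x - U p 0 x) has_real_derivative y' x) (at x)" "y' 0 = 0"
      and y'': "\<And>x. (y' has_real_derivative (4 * A 0 - eps p * V x) * (U p h x - U p 0 x)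
             + (4 * (A h - A 0) * U p h x + \<beta> * h / 2 + eps p * r x)) (at x)"
      and r: "\<And>x. \<bar>r x\<bar> \<le> 4 * S * (U p h x - U p 0 x)\<^sup>2"
      unfolding V_def using U_h_taylor_equation[OF p h] by blast
    obtain z' s where z': "\<And>x. ((\<lambda>x. U p k x - U p 0 x) has_real_derivative z' x) (at x)" "z' 0 = 0"
      and z'': "\<And>x. (z' has_real_derivative (4 * A 0 - eps p * V x) * (U p k x - U p 0 x)
             + (4 * (A k - A 0) * U p k x + \<beta> * k / 2 + eps p * s x)) (at x)"
      and s: "\<And>x. \<bar>s x\<bar> \<le> 4 * S * (U p k x - U p 0 x)\<^sup>2"
      unfolding V_def using U_h_taylor_equation[OF p k] by blast
    have "\<bar>k * (U p h x - U p 0 x) - h * (U p k x - U p 0 x)\<bar> \<le> (K0 * H + R * H / d) * exp (2 * \<mu> * x)"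
    proof (rule growth_bound[where z = "\<lambda>x. k * (U p h x - U p 0 x) - h * (U p k x - U p 0 x)"
          and z' = "\<lambda>x. k * y' x - h * z' x" and Q = "\<lambda>x. 4 * A 0 - eps p * V x"
          and r = "\<lambda>x. 4 * (h * k) * (\<alpha>\<^sub>1 * (U p h x - U p k x) + \<alpha>\<^sub>2 * (h * U p h x - k * U p k x))
               + eps p * (k * r x - h * s x)"])
      show "((\<lambda>x. k * (U p h x - U p 0 x) - h * (U p k x - U p 0 x)) has_real_derivative
          k * y' x - h * z' x) (at x)" for x
        by (intro DERIV_diff DERIV_cmult y' z')
      show "((\<lambda>x. k * y' x - h * z' x) has_real_derivative
          (4 * A 0 - eps p * V x) * (k * (U p h x - U p 0 x) - h * (U p k x - U p 0 x))
          + (4 * (h * k) * (\<alpha>\<^sub>1 * (U p h x - U p k x) + \<alpha>\<^sub>2 * (h * U p h x - k * U p k x))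
               + eps p * (k * r x - h * s x))) (at x)" for x
        by (rule DERIV_cong[OF DERIV_diff[OF DERIV_cmult[OF y''] DERIV_cmult[OF z'']]])
          (simp add: A_eq[of h] A_eq[of k] algebra_simps power2_eq_square)
      show "\<bar>4 * (h * k) * (\<alpha>\<^sub>1 * (U p h x - U p k x) + \<alpha>\<^sub>2 * (h * U p h x - k * U p k x))
               + eps p * (k * r x - h * s x)\<bar> \<le> R * H * exp (2 * \<mu> * x)" if x: "0 \<le> x" for x
      proof -
        define E where "E = exp (\<mu> * x)"
        have E: "1 \<le> E" "exp (2 * \<mu> * x) = E\<^sup>2"
          using exp_mu_ge_1[OF x] by (auto simp: E_def power2_eq_square simp flip: exp_add)
        have EE: "E \<le> E\<^sup>2" using E by (simp add: power2_eq_square)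
        have dh: "\<bar>U p h x - U p 0 x\<bar> \<le> K1 * \<bar>h\<bar> * E" and dk: "\<bar>U p k x - U p 0 x\<bar> \<le> K1 * \<bar>k\<bar> * E"
          unfolding E_def by (intro K1 pT hT kT x)+
        have uh: "0 < U p h x" "U p h x \<le> Ku * E" and uk: "0 < U p k x" "U p k x \<le> Ku * E"
          unfolding E_def using U_pos p h k Ku(2)[OF p5 _ x] hT kT by auto
        have "\<bar>\<alpha>\<^sub>1 * (U p h x - U p k x)\<bar> \<le> \<bar>\<alpha>\<^sub>1\<bar> * (K1 * (\<bar>h\<bar> + \<bar>k\<bar>) * E)"
          unfolding abs_mult using dh dk by (intro mult_left_mono) (auto simp: algebra_simps)
        moreover have "\<bar>\<alpha>\<^sub>2 * (h * U p h x - k * U p k x)\<bar> \<le> \<bar>\<alpha>\<^sub>2\<bar> * (Ku * (\<bar>h\<bar> + \<bar>k\<bar>) * E)"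
        proof -
          have "\<bar>h * U p h x\<bar> \<le> \<bar>h\<bar> * (Ku * E)" "\<bar>k * U p k x\<bar> \<le> \<bar>k\<bar> * (Ku * E)"
            unfolding abs_mult using uh uk by (auto intro!: mult_left_mono)
          then have "\<bar>h * U p h x - k * U p k x\<bar> \<le> \<bar>h\<bar> * (Ku * E) + \<bar>k\<bar> * (Ku * E)" by linarith
          then show ?thesis unfolding abs_mult
            by (intro mult_left_mono) (auto simp: algebra_simps)
        qed
        ultimately have "\<bar>\<alpha>\<^sub>1 * (U p h x - U p k x) + \<alpha>\<^sub>2 * (h * U p h x - k * U p k x)\<bar>
            \<le> \<bar>\<alpha>\<^sub>1\<bar> * (K1 * (\<bar>h\<bar> + \<bar>k\<bar>) * E) + \<bar>\<alpha>\<^sub>2\<bar> * (Ku * (\<bar>h\<bar> + \<bar>k\<bar>) * E)"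
          by linarith
        also have "\<dots> = (\<bar>\<alpha>\<^sub>1\<bar> * K1 + \<bar>\<alpha>\<^sub>2\<bar> * Ku) * (\<bar>h\<bar> + \<bar>k\<bar>) * E"
          by (simp add: algebra_simps)
        also have "\<dots> \<le> (\<bar>\<alpha>\<^sub>1\<bar> * K1 + \<bar>\<alpha>\<^sub>2\<bar> * Ku) * (\<bar>h\<bar> + \<bar>k\<bar>) * E\<^sup>2"
          using EE K1 Ku by (intro mult_left_mono) auto
        finally have "\<bar>4 * (h * k)\<bar> * \<bar>\<alpha>\<^sub>1 * (U p h x - U p k x) + \<alpha>\<^sub>2 * (h * U p h x - k * U p k x)\<bar>
            \<le> \<bar>4 * (h * k)\<bar> * ((\<bar>\<alpha>\<^sub>1\<bar> * K1 + \<bar>\<alpha>\<^sub>2\<bar> * Ku) * (\<bar>h\<bar> + \<bar>k\<bar>) * E\<^sup>2)"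
          by (intro mult_left_mono) auto
        then have one: "\<bar>4 * (h * k) * (\<alpha>\<^sub>1 * (U p h x - U p k x) + \<alpha>\<^sub>2 * (h * U p h x - k * U p k x))\<bar>
            \<le> 4 * (\<bar>\<alpha>\<^sub>1\<bar> * K1 + \<bar>\<alpha>\<^sub>2\<bar> * Ku) * H * E\<^sup>2"
          by (simp only: abs_mult abs_numeral H_def mult_ac)
        have sq: "4 * S * w\<^sup>2 \<le> 4 * S * B\<^sup>2" if "\<bar>w\<bar> \<le> B" for w B
          using power_mono[OF that, of 2] S_ge_1 by (intro mult_left_mono) auto
        have "\<bar>r x\<bar> \<le> 4 * S * (K1 * \<bar>h\<bar> * E)\<^sup>2" "\<bar>s x\<bar> \<le> 4 * S * (K1 * \<bar>k\<bar> * E)\<^sup>2"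
          using order_trans[OF r sq[OF dh]] order_trans[OF s sq[OF dk]] by auto
        then have "\<bar>k * r x\<bar> \<le> \<bar>k\<bar> * (4 * S * (K1 * \<bar>h\<bar> * E)\<^sup>2)"
          "\<bar>h * s x\<bar> \<le> \<bar>h\<bar> * (4 * S * (K1 * \<bar>k\<bar> * E)\<^sup>2)"
          unfolding abs_mult by (auto intro!: mult_left_mono)
        moreover have "\<bar>k\<bar> * (4 * S * (K1 * \<bar>h\<bar> * E)\<^sup>2) + \<bar>h\<bar> * (4 * S * (K1 * \<bar>k\<bar> * E)\<^sup>2)
            = 4 * S * K1\<^sup>2 * H * E\<^sup>2"
          unfolding H_def power2_eq_square
          by (simp only: distrib_left distrib_right mult_ac add_ac)
        ultimately have "\<bar>k * r x - h * s x\<bar> \<le> 4 * S * K1\<^sup>2 * H * E\<^sup>2" by linarith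
        then have "\<bar>eps p * (k * r x - h * s x)\<bar> \<le> b * (4 * S * K1\<^sup>2 * H * E\<^sup>2)"
          unfolding abs_mult using eps_le[OF p(1) delta_p[OF p(2)]] eps(1)[OF p(1)] b
          by (intro mult_mono) auto
        with one show ?thesis unfolding E(2) R_def by (simp add: algebra_simps)
      qed
      show "\<bar>k * (U p h 0 - U p 0 0) - h * (U p k 0 - U p 0 0)\<bar> \<le> K0 * H"
      proof -
        have "k * (U p h 0 - U p 0 0) - h * (U p k 0 - U p 0 0)
            = k * (U p h 0 - U p 0 0 - c * h) - h * (U p k 0 - U p 0 0 - c * k)"
          by (simp add: algebra_simps)
        moreover have "\<bar>k * (U p h 0 - U p 0 0 - c * h)\<bar> \<le> \<bar>k\<bar> * (K0 * h\<^sup>2)"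
          "\<bar>h * (U p k 0 - U p 0 0 - c * k)\<bar> \<le> \<bar>h\<bar> * (K0 * k\<^sup>2)"
          unfolding abs_mult using c[OF hT] c[OF kT] by (auto intro!: mult_left_mono)
        moreover have "\<bar>k\<bar> * (K0 * h\<^sup>2) + \<bar>h\<bar> * (K0 * k\<^sup>2) = K0 * H"
          unfolding H_def power2_abs[of h, symmetric] power2_abs[of k, symmetric]
          by (simp add: algebra_simps power2_eq_square)
        ultimately show ?thesis by linarith
      qed
      have "\<mu>\<^sup>2 \<le> (2 * \<mu>)\<^sup>2" by (simp add: power_mult_distrib)
      then show "4 * A 0 - eps p * V x + d \<le> (2 * \<mu>)\<^sup>2" for x
        using Q_bounds(2)[OF p V] unfolding d_def by (rule order_trans[rotated])
      show "0 \<le> 4 * A 0 - eps p * V x" for x by (rule Q_bounds(1)[OF p V])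
    qed (use y' z' mu d x in auto)
    moreover have "K0 * H + R * H / d = (K0 + R / d) * H" unfolding distrib_right by simp
    ultimately show ?thesis unfolding H_def[symmetric] by simp
  qed
  show ?thesis
    by (intro exI[of _ "K0 + R / d"] conjI ballI allI impI main) (use K0 R d in auto)
qed

definition dU :: "real \<Rightarrow> real \<Rightarrow> real" where "dU p x = deriv (\<lambda>h. U p h x) 0"

lemma U_has_derivative:
  assumes p: "4 \<le> p" "p \<le> 4 + \<delta>"
  shows "((\<lambda>h. U p h x) has_real_derivative dU p x) (at 0)"
proof -
  obtain K where K: "\<And>h k x. h \<in> {-\<tau>..\<tau>} \<Longrightarrow> k \<in> {-\<tau>..\<tau>} \<Longrightarrow> 0 \<le> x \<Longrightarrow>
      \<bar>k * (U p h x - U p 0 x) - h * (U p k x - U p 0 x)\<bar>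
       \<le> K * (\<bar>h\<bar> * \<bar>k\<bar> * (\<bar>h\<bar> + \<bar>k\<bar>)) * exp (2 * \<mu> * x)"
    using U_second_order p by (metis atLeastAtMost_iff)
  have "\<exists>v. ((\<lambda>h. U p h x) has_real_derivative v) (at 0)"
  proof (rule derivative_of_cauchy_quotients[OF tau(1)])
    fix h k assume "\<bar>h\<bar> \<le> \<tau>" "\<bar>k\<bar> \<le> \<tau>"
    then have "h \<in> {-\<tau>..\<tau>}" "k \<in> {-\<tau>..\<tau>}" "\<bar>h\<bar> \<le> \<tau>" "\<bar>k\<bar> \<le> \<tau>" by auto
    then show "\<bar>k * (U p h x - U p 0 x) - h * (U p k x - U p 0 x)\<bar>
        \<le> K * exp (2 * \<mu> * \<bar>x\<bar>) * (\<bar>h\<bar> * \<bar>k\<bar> * (\<bar>h\<bar> + \<bar>k\<bar>))"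
      using K[of h k "\<bar>x\<bar>"] U_abs[OF p(1)] tau by (simp add: mult_ac)
  qed
  then show ?thesis unfolding dU_def using DERIV_imp_deriv by blast
qed

lemma dU_bound:
  "\<exists>K\<ge>0. \<forall>p\<in>{4..4+\<delta>}. \<forall>x. \<bar>dU p x\<bar> \<le> K * exp (\<mu> * \<bar>x\<bar>)"
proof -
  obtain K where K: "0 \<le> K"
    "\<And>p h x. p \<in> {4..4+\<delta>} \<Longrightarrow> h \<in> {-\<tau>..\<tau>} \<Longrightarrow> 0 \<le> x \<Longrightarrow>
       \<bar>U p h x - U p 0 x\<bar> \<le> K * \<bar>h\<bar> * exp (\<mu> * x)"
    using U_h_diff by blast
  have "\<bar>dU p x\<bar> \<le> K * exp (\<mu> * \<bar>x\<bar>)" if "p \<in> {4..4+\<delta>}" for p x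
  proof (rule derivative_bound[OF U_has_derivative tau(1)])
    fix h assume "\<bar>h\<bar> \<le> \<tau>"
    then have "h \<in> {-\<tau>..\<tau>}" "\<bar>h\<bar> \<le> \<tau>" by auto
    then show "\<bar>U p h x - U p 0 x\<bar> \<le> K * exp (\<mu> * \<bar>x\<bar>) * \<bar>h\<bar>"
      using K(2)[OF that, of h "\<bar>x\<bar>"] U_abs[of p] that tau by (simp add: mult_ac)
  qed (use that in auto)
  then show ?thesis using K by blast
qed

lemma dU_p_diff:
  "\<exists>K\<ge>0. \<forall>p\<in>{4..4+\<delta>}. \<forall>x. \<bar>dU p x - dU 4 x\<bar> \<le> K * (p - 4) * exp (\<mu> * \<bar>x\<bar>)"
proof -
  obtain K where K: "0 \<le> K"
    "\<And>p h x. p \<in> {4..4+\<delta>} \<Longrightarrow> h \<in> {-\<tau>..\<tau>} \<Longrightarrow> 0 \<le> x \<Longrightarrow>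
       \<bar>(U p h x - U p 0 x) - (U 4 h x - U 4 0 x)\<bar> \<le> K * \<bar>h\<bar> * (p - 4) * exp (\<mu> * x)"
    using U_mixed_diff by blast
  have "\<bar>dU p x - dU 4 x\<bar> \<le> K * (p - 4) * exp (\<mu> * \<bar>x\<bar>)" if "p \<in> {4..4+\<delta>}" for p x
  proof (rule derivative_bound[OF DERIV_diff[OF U_has_derivative U_has_derivative] tau(1)])
    fix h assume "\<bar>h\<bar> \<le> \<tau>"
    then have "h \<in> {-\<tau>..\<tau>}" "\<bar>h\<bar> \<le> \<tau>" by auto
    then show "\<bar>U p h x - U 4 h x - (U p 0 x - U 4 0 x)\<bar> \<le> K * (p - 4) * exp (\<mu> * \<bar>x\<bar>) * \<bar>h\<bar>"
      using K(2)[OF that, of h "\<bar>x\<bar>"] U_abs[of p] U_abs[of 4] that tau by (simp add: algebra_simps)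
  qed (use that delta in auto)
  then show ?thesis using K by blast
qed

section \<open>From inverse squares back to profiles\<close>

definition \<Phi> :: "real \<Rightarrow> real \<Rightarrow> real \<Rightarrow> real" where
  "\<Phi> p h x = U p h x powr (- (1 / 2))"

definition d\<Phi> :: "real \<Rightarrow> real \<Rightarrow> real" where
  "d\<Phi> p x = - (1 / 2) * U p 0 x powr (- (3 / 2)) * dU p x"

lemma \<Phi>_has_derivative:
  assumes p: "4 \<le> p" "p \<le> 4 + \<delta>"
  shows "((\<lambda>h. \<Phi> p h x) has_real_derivative d\<Phi> p x) (at 0)"
proof -
  have pos: "0 < U p 0 x" using U_pos[OF p(1), of 0 x] tau by simp
  have e: "- (1 / 2) - 1 = - (3 / 2 :: real)" by simp
  have "((\<lambda>u. u powr (- (1 / 2))) has_real_derivative - (1 / 2) * U p 0 x powr (- (1 / 2) - 1))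
      (at (U p 0 x))"
    by (rule has_real_derivative_powr[OF pos])
  from DERIV_chain2[OF this[unfolded e] U_has_derivative[OF p]]
  show ?thesis unfolding \<Phi>_def d\<Phi>_def .
qed

lemma \<Phi>_measurable: "4 \<le> p \<Longrightarrow> \<bar>h\<bar> \<le> \<tau> \<Longrightarrow> \<Phi> p h \<in> borel_measurable lborel"
proof -
  assume "4 \<le> p" "\<bar>h\<bar> \<le> \<tau>"
  then obtain u' where "\<And>x. (U p h has_real_derivative u' x) (at x)" using U_derivs by blast
  then have "continuous_on UNIV (U p h)"
    by (meson DERIV_isCont continuous_at_imp_continuous_on)
  then have "U p h \<in> borel_measurable borel" by (rule borel_measurable_continuous_onI)
  then show ?thesis unfolding \<Phi>_def[abs_def] by simp
qed

text \<open>A pointwise limit of difference quotients of continuous functions is measurable.\<close>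

lemma d\<Phi>_measurable:
  assumes p: "4 \<le> p" "p \<le> 4 + \<delta>"
  shows "d\<Phi> p \<in> borel_measurable lborel"
proof (rule borel_measurable_LIMSEQ_real)
  define s where "s = (\<lambda>n::nat. \<tau> / real (Suc n))"
  have s: "\<bar>s n\<bar> \<le> \<tau>" "s n \<noteq> 0" for n
    using tau by (auto simp: s_def field_simps)
  have s0: "s \<longlonglongrightarrow> 0" unfolding s_def by real_asymp
  show "(\<lambda>x. (\<Phi> p (s n) x - \<Phi> p 0 x) / s n) \<in> borel_measurable lborel" for n
    using \<Phi>_measurable[OF p(1) s(1)[of n]] \<Phi>_measurable[OF p(1), of 0] tau by simp
  fix x
  have lim: "((\<lambda>h. (\<Phi> p h x - \<Phi> p 0 x) / h) \<longlongrightarrow> d\<Phi> p x) (at 0)"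
    using \<Phi>_has_derivative[OF p, of x] by (simp add: DERIV_def)
  have "filterlim s (at 0) sequentially"
    unfolding filterlim_at using s0 s(2) by simp
  from filterlim_compose[OF lim this]
  show "(\<lambda>n. (\<Phi> p (s n) x - \<Phi> p 0 x) / s n) \<longlonglongrightarrow> d\<Phi> p x" .
qed

text \<open>The exponents add up as follows, in units of \<open>\<surd>A\<close>.  A difference of profiles behaves like
  \<open>u powr (-3/2)\<close> times a difference of the \<open>u\<close>: \<open>-3 + 9/4 = -3/4\<close>.  The difference of the
  derivatives contains this rate and a product \<open>u powr (-5/2) (u - v) dU\<close> with the rate
  \<open>-5 + 9/4 + 9/4 = -1/2\<close>, the slower one.  This product is the reason for choosing \<open>\<mu>\<close> so close
  to the true growth rate.\<close>

lemma \<Phi>_decay: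
  "\<exists>M\<ge>0. \<forall>p\<in>{4..4+\<delta>}. \<forall>x.
     \<bar>\<Phi> p 0 x - \<Phi> 4 0 x\<bar> \<le> M * (p - 4) * exp (- (sqrt (A 0) / 2) * \<bar>x\<bar>) \<and>
     \<bar>d\<Phi> p x - d\<Phi> 4 x\<bar> \<le> M * (p - 4) * exp (- (sqrt (A 0) / 2) * \<bar>x\<bar>)"
proof -
  define s where "s = sqrt (A 0)"
  have s: "0 < s" using A0 by (simp add: s_def)
  have 0: "\<bar>0\<bar> \<le> \<tau>" "0 \<in> {-\<tau>..\<tau>}" using tau by auto
  obtain k where k: "0 < k" "\<And>p x. p \<in> {4..5} \<Longrightarrow> 0 \<le> x \<Longrightarrow> k * exp (2 * sqrt (A 0) * x) \<le> U p 0 x"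
    using U_exp_lower by blast
  obtain K1 where K1: "0 \<le> K1"
    "\<And>p h x. p \<in> {4..5} \<Longrightarrow> h \<in> {-\<tau>..\<tau>} \<Longrightarrow> 0 \<le> x \<Longrightarrow>
       \<bar>U p h x - U 4 h x\<bar> \<le> K1 * (p - 4) * exp (\<mu> * x)"
    using U_p_diff by blast
  obtain K2 where K2: "0 \<le> K2"
    "\<And>p x. p \<in> {4..4+\<delta>} \<Longrightarrow> \<bar>dU p x\<bar> \<le> K2 * exp (\<mu> * \<bar>x\<bar>)"
    using dU_bound by blast
  obtain K3 where K3: "0 \<le> K3"
    "\<And>p x. p \<in> {4..4+\<delta>} \<Longrightarrow> \<bar>dU p x - dU 4 x\<bar> \<le> K3 * (p - 4) * exp (\<mu> * \<bar>x\<bar>)"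
    using dU_p_diff by blast
  define M1 where "M1 = k powr - (3 / 2) * K1"
  define M2 where "M2 = k powr - (3 / 2) * K3 + 3 / 2 * k powr - (5 / 2) * K1 * K2"
  have M: "0 \<le> M1" "0 \<le> M2" using K1 K2 K3 by (auto simp: M1_def M2_def)
  have main: "\<bar>\<Phi> p 0 x - \<Phi> 4 0 x\<bar> \<le> M1 * (p - 4) * exp (- (s / 2) * \<bar>x\<bar>) \<and>
     \<bar>d\<Phi> p x - d\<Phi> 4 x\<bar> \<le> M2 * (p - 4) * exp (- (s / 2) * \<bar>x\<bar>)" if pT: "p \<in> {4..4+\<delta>}" for p x
  proof -
    have p: "4 \<le> p" and p5: "p \<in> {4..5}" and p4: "4 \<in> {4..4+\<delta>}" "4 \<in> {4..5::real}"
      using pT delta by auto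
    define y where "y = \<bar>x\<bar>"
    have y: "0 \<le> y" by (simp add: y_def)
    define u where "u = U p 0 x"
    define v where "v = U 4 0 x"
    define l where "l = k * exp (2 * s * y)"
    have l: "0 < l" using k by (simp add: l_def)
    have lu: "l \<le> u" and lv: "l \<le> v"
      using k(2)[OF p5 y] k(2)[OF p4(2) y] U_abs[OF p 0(1), of x] U_abs[of 4 0 x] 0
      by (auto simp: l_def u_def v_def s_def y_def)
    have lp: "l powr - e = k powr - e * exp (- (2 * e * s) * y)" for e
      using k by (simp add: l_def powr_mult exp_powr_real mult_ac)
    have E1: "exp (- (2 * (3 / 2) * s) * y) * exp (9 / 4 * s * y) = exp (- (3 / 4 * s) * y)"
      unfolding exp_add[symmetric] by (simp add: field_simps)
    have E2: "exp (- (2 * (5 / 2) * s) * y) * exp (9 / 4 * s * y) * exp (9 / 4 * s * y)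
        = exp (- (1 / 2 * s) * y)"
      unfolding exp_add[symmetric] by (simp add: field_simps)
    have uv: "\<bar>u - v\<bar> \<le> K1 * (p - 4) * exp (9 / 4 * s * y)"
      using K1(2)[OF p5 0(2) y] U_abs[OF p 0(1), of x] U_abs[of 4 0 x] 0
      by (simp add: u_def v_def s_def y_def \<mu>_def)
    have decay: "exp (- (r * s) * y) \<le> exp (- (s / 2) * y)" if "1 / 2 \<le> r" for r
    proof -
      have "1 / 2 * (s * y) \<le> r * (s * y)" using that s y by (intro mult_right_mono) auto
      then show ?thesis by (simp add: mult_ac)
    qed
    obtain V where V: "0 \<le> V" "V \<le> 1 / 2 * l powr - (3 / 2)"
      "u powr - (1 / 2) - v powr - (1 / 2) = - V * (u - v)"
      using powr_neg_slope[OF l lu lv, of "1 / 2"] by auto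
    have "\<bar>\<Phi> p 0 x - \<Phi> 4 0 x\<bar> = V * \<bar>u - v\<bar>"
      using V unfolding \<Phi>_def u_def[symmetric] v_def[symmetric] by (simp add: abs_mult)
    also have "\<dots> \<le> l powr - (3 / 2) * (K1 * (p - 4) * exp (9 / 4 * s * y))"
      using V uv by (intro mult_mono) auto
    also have "\<dots> = M1 * (p - 4) * exp (- (3 / 4 * s) * y)"
      unfolding E1[symmetric] lp M1_def by (simp only: mult_ac)
    also have "\<dots> \<le> M1 * (p - 4) * exp (- (s / 2) * y)"
      using decay[of "3 / 4"] M p by (intro mult_left_mono) auto
    finally have one: "\<bar>\<Phi> p 0 x - \<Phi> 4 0 x\<bar> \<le> M1 * (p - 4) * exp (- (s / 2) * y)" .
    obtain W where W: "0 \<le> W" "W \<le> 3 / 2 * l powr - (5 / 2)"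
      "u powr - (3 / 2) - v powr - (3 / 2) = - W * (u - v)"
      using powr_neg_slope[OF l lu lv, of "3 / 2"] by auto
    have "d\<Phi> p x - d\<Phi> 4 x
        = - (1 / 2) * (u powr - (3 / 2) * (dU p x - dU 4 x)
                       + (u powr - (3 / 2) - v powr - (3 / 2)) * dU 4 x)"
      by (simp add: d\<Phi>_def u_def v_def algebra_simps)
    also have "\<dots> = - (1 / 2) * (u powr - (3 / 2) * (dU p x - dU 4 x) - W * (u - v) * dU 4 x)"
      unfolding W(3) by simp
    finally have eq: "d\<Phi> p x - d\<Phi> 4 x = \<dots>" .
    have half: "\<bar>- (1 / 2) * (X - Y)\<bar> \<le> \<bar>X\<bar> + \<bar>Y\<bar>" for X Y :: real
    proof -
      have "\<bar>- (1 / 2) * (X - Y)\<bar> = \<bar>X - Y\<bar> / 2" unfolding abs_mult by simp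
      then show ?thesis
        using abs_triangle_ineq4[of X Y] abs_ge_zero[of X] abs_ge_zero[of Y] by argo
    qed
    have "\<bar>d\<Phi> p x - d\<Phi> 4 x\<bar> \<le> \<bar>u powr - (3 / 2) * (dU p x - dU 4 x)\<bar> + \<bar>W * (u - v) * dU 4 x\<bar>"
      unfolding eq by (rule half)
    also have "\<bar>u powr - (3 / 2) * (dU p x - dU 4 x)\<bar>
        \<le> l powr - (3 / 2) * (K3 * (p - 4) * exp (9 / 4 * s * y))"
    proof -
      have "u powr - (3 / 2) \<le> l powr - (3 / 2)" using l lu by (intro powr_mono2') auto
      then show ?thesis unfolding abs_mult
        using K3(2)[OF pT, of x] by (intro mult_mono) (auto simp: s_def y_def \<mu>_def)
    qed
    also have "\<bar>W * (u - v) * dU 4 x\<bar>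
        \<le> (3 / 2 * l powr - (5 / 2)) * (K1 * (p - 4) * exp (9 / 4 * s * y)) * (K2 * exp (9 / 4 * s * y))"
      unfolding abs_mult using W uv K2(2)[OF p4(1), of x] K1 p
      by (intro mult_mono mult_nonneg_nonneg) (auto simp: s_def y_def \<mu>_def)
    also have "l powr - (3 / 2) * (K3 * (p - 4) * exp (9 / 4 * s * y))
        = k powr - (3 / 2) * K3 * (p - 4) * exp (- (3 / 4 * s) * y)"
      unfolding E1[symmetric] lp by (simp only: mult_ac)
    also have "(3 / 2 * l powr - (5 / 2)) * (K1 * (p - 4) * exp (9 / 4 * s * y)) * (K2 * exp (9 / 4 * s * y))
        = 3 / 2 * k powr - (5 / 2) * K1 * K2 * (p - 4) * exp (- (1 / 2 * s) * y)"
      unfolding E2[symmetric] lp by (simp only: mult_ac)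
    also have "k powr - (3 / 2) * K3 * (p - 4) * exp (- (3 / 4 * s) * y)
          + 3 / 2 * k powr - (5 / 2) * K1 * K2 * (p - 4) * exp (- (1 / 2 * s) * y)
        \<le> k powr - (3 / 2) * K3 * (p - 4) * exp (- (s / 2) * y)
          + 3 / 2 * k powr - (5 / 2) * K1 * K2 * (p - 4) * exp (- (s / 2) * y)"
      using decay[of "3 / 4"] decay[of "1 / 2"] p K1 K2 K3
      by (intro add_mono mult_left_mono mult_nonneg_nonneg) auto
    also have "\<dots> = M2 * (p - 4) * exp (- (s / 2) * y)"
      unfolding M2_def distrib_right by simp
    finally have "\<bar>d\<Phi> p x - d\<Phi> 4 x\<bar> \<le> M2 * (p - 4) * exp (- (s / 2) * y)" by simp
    with one show ?thesis by (simp add: y_def)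
  qed
  show ?thesis
  proof (intro exI[of _ "M1 + M2"] conjI ballI allI)
    show "0 \<le> M1 + M2" using M by simp
    fix p x assume pT: "p \<in> {4..4+\<delta>}"
    have mono: "M' * (p - 4) * exp (- (s / 2) * \<bar>x\<bar>) \<le> (M1 + M2) * (p - 4) * exp (- (s / 2) * \<bar>x\<bar>)"
      if "M' \<le> M1 + M2" for M'
      using that pT by (intro mult_right_mono) auto
    show "\<bar>\<Phi> p 0 x - \<Phi> 4 0 x\<bar> \<le> (M1 + M2) * (p - 4) * exp (- (sqrt (A 0) / 2) * \<bar>x\<bar>)"
      using order_trans[OF conjunct1[OF main[OF pT, of x]] mono[of M1]] M by (simp add: s_def)
    show "\<bar>d\<Phi> p x - d\<Phi> 4 x\<bar> \<le> (M1 + M2) * (p - 4) * exp (- (sqrt (A 0) / 2) * \<bar>x\<bar>)"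
      using order_trans[OF conjunct2[OF main[OF pT, of x]] mono[of M2]] M by (simp add: s_def)
  qed
qed

lemma \<Phi>_norm_estimates:
  "\<exists>K\<ge>0. \<forall>p\<in>{4..4+\<delta>}.
     Linf_norm (\<lambda>x. \<Phi> p 0 x - \<Phi> 4 0 x) \<le> ereal (K * (p - 4)) \<and>
     L2_norm (\<lambda>x. \<Phi> p 0 x - \<Phi> 4 0 x) \<le> ereal (K * (p - 4)) \<and>
     L2_norm (\<lambda>x. d\<Phi> p x - d\<Phi> 4 x) \<le> ereal (K * (p - 4))"
proof -
  define \<sigma> where "\<sigma> = sqrt (A 0) / 2"
  have \<sigma>: "0 < \<sigma>" using A0 by (simp add: \<sigma>_def)
  have J: "0 \<le> L2_decay_const \<sigma>" by (simp add: L2_decay_const_def)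
  obtain M where M: "0 \<le> M" "\<And>p x. p \<in> {4..4+\<delta>} \<Longrightarrow>
      \<bar>\<Phi> p 0 x - \<Phi> 4 0 x\<bar> \<le> M * (p - 4) * exp (- \<sigma> * \<bar>x\<bar>)"
    "\<And>p x. p \<in> {4..4+\<delta>} \<Longrightarrow> \<bar>d\<Phi> p x - d\<Phi> 4 x\<bar> \<le> M * (p - 4) * exp (- \<sigma> * \<bar>x\<bar>)"
    using \<Phi>_decay unfolding \<sigma>_def by blast
  show ?thesis
  proof (intro exI[of _ "M * (1 + L2_decay_const \<sigma>)"] conjI ballI)
    show "0 \<le> M * (1 + L2_decay_const \<sigma>)" using M J by simp
    fix p assume pT: "p \<in> {4..4+\<delta>}"
    then have p: "4 \<le> p" "p \<le> 4 + \<delta>" and p4: "(4::real) \<le> 4" "4 \<le> 4 + \<delta>" using delta by auto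
    have 0: "\<bar>0\<bar> \<le> \<tau>" using tau by simp
    have B: "0 \<le> M * (p - 4)" using M p by simp
    have "M * (1 + L2_decay_const \<sigma>) * (p - 4) = M * (p - 4) + M * (p - 4) * L2_decay_const \<sigma>"
      by (simp add: algebra_simps)
    moreover have "0 \<le> M * (p - 4) * L2_decay_const \<sigma>" using B J by simp
    ultimately have le: "M * (p - 4) \<le> M * (1 + L2_decay_const \<sigma>) * (p - 4)"
      "M * (p - 4) * L2_decay_const \<sigma> \<le> M * (1 + L2_decay_const \<sigma>) * (p - 4)"
      using B by linarith+
    have m1: "(\<lambda>x. \<Phi> p 0 x - \<Phi> 4 0 x) \<in> borel_measurable lborel"
      using \<Phi>_measurable[OF p(1) 0] \<Phi>_measurable[OF p4(1) 0] by measurable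
    have m2: "(\<lambda>x. d\<Phi> p x - d\<Phi> 4 x) \<in> borel_measurable lborel"
      using d\<Phi>_measurable[OF p] d\<Phi>_measurable[OF p4] by measurable
    note n1 = norms_of_decaying[OF m1 \<sigma> B M(2)[OF pT]]
    note n2 = norms_of_decaying[OF m2 \<sigma> B M(3)[OF pT]]
    show "Linf_norm (\<lambda>x. \<Phi> p 0 x - \<Phi> 4 0 x) \<le> ereal (M * (1 + L2_decay_const \<sigma>) * (p - 4))"
      using n1(1) le(1) by (meson ereal_less_eq(3) order_trans)
    show "L2_norm (\<lambda>x. \<Phi> p 0 x - \<Phi> 4 0 x) \<le> ereal (M * (1 + L2_decay_const \<sigma>) * (p - 4))"
      using n1(2) le(2) by (meson ereal_less_eq(3) order_trans)
    show "L2_norm (\<lambda>x. d\<Phi> p x - d\<Phi> 4 x) \<le> ereal (M * (1 + L2_decay_const \<sigma>) * (p - 4))"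
      using n2(2) le(2) by (meson ereal_less_eq(3) order_trans)
  qed
qed

end

lemma admissible_parameters:
  assumes "0 < w - d\<^sup>2 / 4"
  shows "0 < w" "- 2 * sqrt w < d" "d < 2 * sqrt w"
proof -
  show "0 < w" using assms zero_le_power2[of d] by linarith
  have "(\<bar>d\<bar> / 2)\<^sup>2 < w" using assms by (simp add: power_divide)
  then have "\<bar>d\<bar> / 2 < sqrt w" by (rule real_less_rsqrt)
  then show "- 2 * sqrt w < d" "d < 2 * sqrt w" by linarith+
qed

text \<open>The line starts at \<open>(w, d)\<close> with direction \<open>(\<eta>, \<beta>)\<close>; the two coordinate directions give the two
  partial derivatives.\<close>

lemma profile_estimates_along_line:
  fixes \<phi> :: "real \<Rightarrow> real \<Rightarrow> real \<Rightarrow> real \<Rightarrow> real"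
  assumes b: "0 \<le> b" and A: "0 < w - d\<^sup>2 / 4"
    and profiles: "\<And>p w d. 4 \<le> p \<Longrightarrow> 0 < w - d\<^sup>2 / 4 \<Longrightarrow> is_profile b p w d (\<phi> p w d)"
  shows "\<exists>K\<ge>0. \<exists>\<delta>>0. \<forall>p\<in>{4..4+\<delta>}.
     Linf_norm (\<lambda>x. \<phi> p w d x - \<phi> 4 w d x) \<le> ereal (K * (p - 4)) \<and>
     L2_norm (\<lambda>x. \<phi> p w d x - \<phi> 4 w d x) \<le> ereal (K * (p - 4)) \<and>
     (\<forall>x. (\<lambda>h. \<phi> p (w + \<eta> * h) (d + \<beta> * h) x) differentiable (at 0)) \<and>
     L2_norm (\<lambda>x. deriv (\<lambda>h. \<phi> p (w + \<eta> * h) (d + \<beta> * h) x) 0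
                  - deriv (\<lambda>h. \<phi> 4 (w + \<eta> * h) (d + \<beta> * h) x) 0) \<le> ereal (K * (p - 4))"
proof -
  define A where "A = (\<lambda>h. w + \<eta> * h - (d + \<beta> * h)\<^sup>2 / 4)"
  define C where "C = (\<lambda>h. d + \<beta> * h)"
  define \<alpha>1 where "\<alpha>1 = \<eta> - d * \<beta> / 2"
  define \<alpha>2 where "\<alpha>2 = - \<beta>\<^sup>2 / 4"
  define U where "U = (\<lambda>p h x. 1 / (\<phi> p (w + \<eta> * h) (d + \<beta> * h) x)\<^sup>2)"
  have A0: "0 < A 0" using A by (simp add: A_def)
  \<comment> \<open>The summand 1 keeps the denominator positive when both coefficients vanish.\<close>
  define \<tau> where "\<tau> = min 1 (A 0 / (8 * (1 + \<bar>\<alpha>1\<bar> + \<bar>\<alpha>2\<bar>)))"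
  have tau: "0 < \<tau>" "\<tau> \<le> 1" using A0 by (auto simp: \<tau>_def intro!: divide_pos_pos add_pos_nonneg)
  have A_eq: "A h = A 0 + \<alpha>1 * h + \<alpha>2 * h\<^sup>2" for h
    by (simp add: A_def \<alpha>1_def \<alpha>2_def power2_eq_square field_simps)
  have tau8: "8 * (1 + \<bar>\<alpha>1\<bar> + \<bar>\<alpha>2\<bar>) * \<tau> \<le> A 0"
  proof -
    have "0 < 8 * (1 + \<bar>\<alpha>1\<bar> + \<bar>\<alpha>2\<bar>)" by (simp add: add_pos_nonneg)
    moreover have "\<tau> \<le> A 0 / (8 * (1 + \<bar>\<alpha>1\<bar> + \<bar>\<alpha>2\<bar>))" by (simp add: \<tau>_def)
    ultimately show ?thesis by (simp add: pos_le_divide_eq mult.commute)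
  qed
  then have tau_small: "8 * (\<bar>\<alpha>1\<bar> + \<bar>\<alpha>2\<bar>) * \<tau> \<le> A 0" using tau by (simp add: algebra_simps)
  have Apos: "0 < A h" if h: "\<bar>h\<bar> \<le> \<tau>" for h
  proof -
    have "\<bar>\<alpha>1 * h\<bar> \<le> \<bar>\<alpha>1\<bar> * \<tau>" unfolding abs_mult using h by (intro mult_left_mono) auto
    moreover have "\<bar>\<alpha>2 * h\<^sup>2\<bar> \<le> \<bar>\<alpha>2\<bar> * \<tau>"
    proof -
      have "h\<^sup>2 \<le> \<bar>h\<bar>" using power_decreasing[of 1 2 "\<bar>h\<bar>"] h tau by simp
      then have "h\<^sup>2 \<le> \<tau>" using h by simp
      then show ?thesis unfolding abs_mult by (intro mult_left_mono) auto
    qed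
    moreover have "8 * (\<bar>\<alpha>1\<bar> * \<tau>) + 8 * (\<bar>\<alpha>2\<bar> * \<tau>) \<le> A 0" using tau_small by (simp add: algebra_simps)
    ultimately show ?thesis using A_eq[of h] A0 by linarith
  qed
  have prof: "is_profile b p (w + \<eta> * h) (d + \<beta> * h) (\<phi> p (w + \<eta> * h) (d + \<beta> * h))"
    if "4 \<le> p" "\<bar>h\<bar> \<le> \<tau>" for p h
    using profiles[OF that(1)] Apos[OF that(2)] by (simp add: A_def)
  interpret profile_curve b \<alpha>1 \<alpha>2 \<beta> \<tau> A C U
  proof
    show "inv_square_profile b p (A h) (C h) (U p h)" if "4 \<le> p" "\<bar>h\<bar> \<le> \<tau>" for p h
      using inv_square_profile[OF prof[OF that] that(1) b] by (simp add: A_def C_def U_def)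
    show "A h = A 0 + \<alpha>1 * h + \<alpha>2 * h\<^sup>2" for h by (rule A_eq)
    show "C h = C 0 + \<beta> * h" for h by (simp add: C_def)
  qed (fact b A0 tau tau_small)+
  have \<Phi>: "\<Phi> p h x = \<phi> p (w + \<eta> * h) (d + \<beta> * h) x" if "4 \<le> p" "\<bar>h\<bar> \<le> \<tau>" for p h x
  proof -
    define y where "y = \<phi> p (w + \<eta> * h) (d + \<beta> * h) x"
    have y: "0 < y" using prof[OF that] by (simp add: is_profile_def y_def)
    then have "1 / y\<^sup>2 = y powr - 2"
      by (simp add: powr_minus divide_simps flip: powr_numeral)
    then have "(1 / y\<^sup>2) powr - (1 / 2) = y" using y by (simp add: powr_powr)
    then show ?thesis unfolding \<Phi>_def by (simp add: U_def y_def)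
  qed
  have der: "((\<lambda>h. \<phi> p (w + \<eta> * h) (d + \<beta> * h) x) has_real_derivative d\<Phi> p x) (at 0)"
    if "p \<in> {4..4+\<delta>}" for p x
  proof (rule has_field_derivative_transform_within[OF \<Phi>_has_derivative tau(1)])
    show "\<Phi> p h x = \<phi> p (w + \<eta> * h) (d + \<beta> * h) x" if "dist h 0 < \<tau>" for h
      using that \<open>p \<in> _\<close> by (intro \<Phi>) auto
  qed (use that in auto)
  obtain K where K: "0 \<le> K" "\<And>p. p \<in> {4..4+\<delta>} \<Longrightarrow>
     Linf_norm (\<lambda>x. \<Phi> p 0 x - \<Phi> 4 0 x) \<le> ereal (K * (p - 4)) \<and>
     L2_norm (\<lambda>x. \<Phi> p 0 x - \<Phi> 4 0 x) \<le> ereal (K * (p - 4)) \<and>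
     L2_norm (\<lambda>x. d\<Phi> p x - d\<Phi> 4 x) \<le> ereal (K * (p - 4))"
    using \<Phi>_norm_estimates by blast
  show ?thesis
  proof (rule exI[of _ K], rule conjI[OF K(1)], rule exI[of _ \<delta>], intro conjI ballI delta(1))
    fix p assume pT: "p \<in> {4..4+\<delta>}"
    have p4: "4 \<in> {4..4+\<delta>}" using delta by simp
    have eq: "\<Phi> p 0 x - \<Phi> 4 0 x = \<phi> p w d x - \<phi> 4 w d x" for x
      using \<Phi>[of p 0 x] \<Phi>[of 4 0 x] pT tau by simp
    show "Linf_norm (\<lambda>x. \<phi> p w d x - \<phi> 4 w d x) \<le> ereal (K * (p - 4))"
      "L2_norm (\<lambda>x. \<phi> p w d x - \<phi> 4 w d x) \<le> ereal (K * (p - 4))"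
      using K(2)[OF pT] unfolding eq by auto
    show "\<forall>x. (\<lambda>h. \<phi> p (w + \<eta> * h) (d + \<beta> * h) x) differentiable (at 0)"
      using der[OF pT] real_differentiable_def by blast
    show "L2_norm (\<lambda>x. deriv (\<lambda>h. \<phi> p (w + \<eta> * h) (d + \<beta> * h) x) 0
                  - deriv (\<lambda>h. \<phi> 4 (w + \<eta> * h) (d + \<beta> * h) x) 0) \<le> ereal (K * (p - 4))"
      using K(2)[OF pT] unfolding DERIV_imp_deriv[OF der[OF pT]] DERIV_imp_deriv[OF der[OF p4]] by auto
  qed
qed

lemma deriv_shift_zero:
  fixes g :: "real \<Rightarrow> real"
  shows "deriv (\<lambda>h. g (x + h)) 0 = deriv g x"
    and "(\<lambda>h. g (x + h)) differentiable (at 0) \<longleftrightarrow> g differentiable (at x)"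
proof -
  have "((\<lambda>h. g (x + h)) has_real_derivative D) (at 0) \<longleftrightarrow> (g has_real_derivative D) (at x)" for D
    using DERIV_shift[of g D 0 x] by (simp add: add.commute)
  then show "deriv (\<lambda>h. g (x + h)) 0 = deriv g x"
    and "(\<lambda>h. g (x + h)) differentiable (at 0) \<longleftrightarrow> g differentiable (at x)"
    unfolding deriv_def real_differentiable_def by simp_all
qed

lemma le_root_4:
  assumes "0 \<le> y" "y \<le> (1::real)"
  shows "y \<le> root 4 y"
proof -
  have r: "0 \<le> root 4 y" "root 4 y \<le> 1" "root 4 y ^ 4 = y"
    using assms by (auto simp: real_root_pow_pos2)
  then show ?thesis using power_decreasing[of 1 4 "root 4 y"] by simp
qed

theorem lemma2p8:
  fixes b \<omega> c a \<gamma> k0 :: real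
    and \<phi> :: "real \<Rightarrow> real \<Rightarrow> real \<Rightarrow> real \<Rightarrow> real"
  assumes "b \<ge> 0" and "\<omega> > 0" and "- 2 * sqrt \<omega> < c" and "c < 2 * sqrt \<omega>"
    and "a = \<omega> - c\<^sup>2 / 4" and "\<gamma> = 1 + 16 * b / 3"
    and "k0 = 1 / \<gamma> * (2 * c + 2 * sqrt (c\<^sup>2 + 4 * a * \<gamma>))"
    and "k0 > exp (1 / 3)"
    and profiles: "\<And>p w d. p \<ge> 4 \<Longrightarrow> w > 0 \<Longrightarrow> - 2 * sqrt w < d \<Longrightarrow> d < 2 * sqrt w \<Longrightarrow>
           is_profile b p w d (\<phi> p w d)"
  shows "\<exists>C>0. \<exists>\<delta>>0. \<forall>p. 4 \<le> p \<and> p < 4 + \<delta> \<longrightarrow>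
           Linf_norm (\<lambda>x. \<phi> p \<omega> c x - \<phi> 4 \<omega> c x) \<le> ereal (C * root 4 (p - 4)) \<and>
           L2_norm (\<lambda>x. \<phi> p \<omega> c x - \<phi> 4 \<omega> c x) \<le> ereal (C * root 4 (p - 4)) \<and>
           (\<forall>x. (\<lambda>w. \<phi> p w c x) differentiable (at \<omega>)) \<and>
           (\<forall>x. (\<lambda>d. \<phi> p \<omega> d x) differentiable (at c)) \<and>
           L2_norm (\<lambda>x. d_omega \<phi> p \<omega> c x - d_omega \<phi> 4 \<omega> c x) \<le> ereal (C * root 4 (p - 4)) \<and>
           L2_norm (\<lambda>x. d_c \<phi> p \<omega> c x - d_c \<phi> 4 \<omega> c x) \<le> ereal (C * root 4 (p - 4))"
proof -
  have pos: "0 < \<omega> - c\<^sup>2 / 4"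
  proof -
    have "\<bar>c\<bar> < 2 * sqrt \<omega>" using assms(3,4) by linarith
    then have "\<bar>c\<bar>\<^sup>2 < (2 * sqrt \<omega>)\<^sup>2" by (intro power_strict_mono) auto
    then show ?thesis using \<open>0 < \<omega>\<close> by (simp add: power_mult_distrib)
  qed
  have prof: "is_profile b p w d (\<phi> p w d)" if "4 \<le> p" "0 < w - d\<^sup>2 / 4" for p w d
    using profiles[OF that(1)] admissible_parameters[OF that(2)] by blast
  note line = profile_estimates_along_line[of b \<omega> c \<phi>, OF \<open>b \<ge> 0\<close> pos prof]
  obtain K1 \<delta>1 where K1: "0 \<le> K1" "0 < \<delta>1" "\<And>p. p \<in> {4..4+\<delta>1} \<Longrightarrow>
     Linf_norm (\<lambda>x. \<phi> p \<omega> c x - \<phi> 4 \<omega> c x) \<le> ereal (K1 * (p - 4)) \<and>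
     L2_norm (\<lambda>x. \<phi> p \<omega> c x - \<phi> 4 \<omega> c x) \<le> ereal (K1 * (p - 4)) \<and>
     (\<forall>x. (\<lambda>h. \<phi> p (\<omega> + h) c x) differentiable (at 0)) \<and>
     L2_norm (\<lambda>x. deriv (\<lambda>h. \<phi> p (\<omega> + h) c x) 0 - deriv (\<lambda>h. \<phi> 4 (\<omega> + h) c x) 0) \<le> ereal (K1 * (p - 4))"
    using line[of 1 0] by auto
  obtain K2 \<delta>2 where K2: "0 \<le> K2" "0 < \<delta>2" "\<And>p. p \<in> {4..4+\<delta>2} \<Longrightarrow>
     (\<forall>x. (\<lambda>h. \<phi> p \<omega> (c + h) x) differentiable (at 0)) \<and>
     L2_norm (\<lambda>x. deriv (\<lambda>h. \<phi> p \<omega> (c + h) x) 0 - deriv (\<lambda>h. \<phi> 4 \<omega> (c + h) x) 0) \<le> ereal (K2 * (p - 4))"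
    using line[of 0 1] by auto
  show ?thesis
  proof (intro exI conjI allI impI)
    show "0 < K1 + K2 + 1" using K1 K2 by simp
    show "0 < min 1 (min \<delta>1 \<delta>2)" using K1 K2 by simp
    fix p assume p: "4 \<le> p \<and> p < 4 + min 1 (min \<delta>1 \<delta>2)"
    then have p1: "p \<in> {4..4+\<delta>1}" and p2: "p \<in> {4..4+\<delta>2}" and p01: "0 \<le> p - 4" "p - 4 \<le> 1" by auto
    have le: "y \<le> ereal ((K1 + K2 + 1) * root 4 (p - 4))"
      if "y \<le> ereal (K * (p - 4))" "0 \<le> K" "K \<le> K1 + K2 + 1" for y K
    proof -
      have "K * (p - 4) \<le> (K1 + K2 + 1) * root 4 (p - 4)"
        using le_root_4[OF p01] that p01 by (intro mult_mono) auto
      with that(1) show ?thesis by (meson ereal_less_eq(3) order_trans)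
    qed
    note est1 = K1(3)[OF p1] and est2 = K2(3)[OF p2]
    show "Linf_norm (\<lambda>x. \<phi> p \<omega> c x - \<phi> 4 \<omega> c x) \<le> ereal ((K1 + K2 + 1) * root 4 (p - 4))"
      "L2_norm (\<lambda>x. \<phi> p \<omega> c x - \<phi> 4 \<omega> c x) \<le> ereal ((K1 + K2 + 1) * root 4 (p - 4))"
      using est1 K1(1) K2(1) by (auto intro!: le[of _ K1])
    show "(\<lambda>w. \<phi> p w c x) differentiable (at \<omega>)" for x
      using est1 deriv_shift_zero(2)[of "\<lambda>w. \<phi> p w c x" \<omega>] by blast
    show "(\<lambda>d. \<phi> p \<omega> d x) differentiable (at c)" for x
      using est2 deriv_shift_zero(2)[of "\<lambda>d. \<phi> p \<omega> d x" c] by blast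
    show "L2_norm (\<lambda>x. d_omega \<phi> p \<omega> c x - d_omega \<phi> 4 \<omega> c x) \<le> ereal ((K1 + K2 + 1) * root 4 (p - 4))"
      unfolding d_omega_def deriv_shift_zero(1)[of "\<lambda>w. \<phi> _ w c _" \<omega>, symmetric]
      using est1 K1(1) K2(1) by (intro le[of _ K1]) auto
    show "L2_norm (\<lambda>x. d_c \<phi> p \<omega> c x - d_c \<phi> 4 \<omega> c x) \<le> ereal ((K1 + K2 + 1) * root 4 (p - 4))"
      unfolding d_c_def deriv_shift_zero(1)[of "\<lambda>d. \<phi> _ \<omega> d _" c, symmetric]
      using est2 K1(1) K2(1) by (intro le[of _ K2]) auto
  qed
qed

end
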